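(* Let $\Omega\subset\mathbb{R}^3$ be a smooth, bounded, connected domain, let $D_1,D_2,\epsilon,\nu,K>0$ be constants, and let $\gamma_1,\gamma_2,W$ be smooth functions on $\partial\Omega$ with $\gamma_1,\gamma_2>0$ (time independent, not necessarily constant). Suppose $(c_1\ge0,c_2\ge0,u)$ is the unique, global smooth solution of $$\partial_tc_1+u\cdot\nabla c_1=D_1\operatorname{div}(\nabla c_1+c_1\nabla\Phi),\qquad \partial_tc_2+u\cdot\nabla c_2=D_2\operatorname{div}(\nabla c_2-c_2\nabla\Phi),$$ $$-\epsilon\Delta\Phi=\rho=c_1-c_2,\qquad \partial_tu-\nu\Delta u+\nabla p=-K\rho\nabla\Phi,\qquad \operatorname{div}u=0$$ on $\Omega$ with smooth initial conditions $(c_1(0)\ge0,c_2(0)\ge0,u(0))$, $\operatorname{div}u(0)=0$, and boundary conditions $$c_i|_{\partial\Omega}=\gamma_i\ (i=1,2),\qquad \Phi|_{\partial\Omega}=W,\qquad u|_{\partial\Omega}=0.$$ Let $\underline\gamma=\min_i\inf_{\partial\Omega}\gamma_i$ and $\overline\gamma=\max_i\sup_{\partial\Omega}\gamma_i$. Then: (I) For $i=1,2$, all $t\ge0$ and all $x\in\Omega$, $$\min\{\inf_\Omega c_1(0),\inf_\Omega c_2(0),\underline\gamma\}\le c_i(t,x)\le\max\{\sup_\Omega c_1(0),\sup_\Omega c_2(0),\overline\gamma\}.$$ In particular, the functions $$\overline M(t)=\max_i\sup_{x\in\Omega}c_i(t,x),\qquad \underline M(t)=\min_i\inf_{x\in\Omega}c_i(t,x)$$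 are nonincreasing and nondecreasing on $(0,\infty)$, respectively. (II) For all $\delta>0$, there exists $T$ depending on $\delta$, $\Omega$ and the initial and boundary conditions such that for all $t\ge T$, $$\underline\gamma-\delta\le\underline M(t)\le\overline M(t)\le\overline\gamma+\delta.$$
   Context: Here $c_1,c_2,\Phi,p$ are real valued functions of $(t,x)$ and $u$ is an $\mathbb{R}^3$-valued vector field; $c_i(0)$, $u(0)$ denote the values at time $t=0$. Global existence and uniqueness of smooth solutions of this system with these Dirichlet boundary conditions is known. *)

theory Defs
  imports "HOL-Analysis.Analysis"
begin

text \<open>\<open>Ck_on k f U\<close> is only meant for open sets \<open>U\<close>.\<close>

primrec Ck_on ::
  "nat \<Rightarrow> ('a::real_normed_vector \<Rightarrow> 'b::real_normed_vector) \<Rightarrow> 'a set \<Rightarrow> bool" where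
  "Ck_on 0 f U \<longleftrightarrow> continuous_on U f"
| "Ck_on (Suc k) f U \<longleftrightarrow>
     f differentiable_on U \<and> (\<forall>v. Ck_on k (\<lambda>x. frechet_derivative f (at x) v) U)"

text \<open>Smoothness on an arbitrary set means that there are local smooth extensions. For \<open>closure \<Omega>\<close>
  this is smoothness up to the boundary; for \<open>frontier \<Omega>\<close> (a smooth hypersurface) it is the
  usual notion of a smooth function on that manifold.\<close>

definition smooth_on ::
  "'a::real_normed_vector set \<Rightarrow> ('a \<Rightarrow> 'b::real_normed_vector) \<Rightarrow> bool" where
  "smooth_on S f \<longleftrightarrow>
     (\<forall>x\<in>S. \<exists>U g. open U \<and> x \<in> U \<and> (\<forall>k. Ck_on k g U) \<and> (\<forall>y\<in>S \<inter> U. g y = f y))"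

definition partial :: "'n::finite \<Rightarrow> (real^'n \<Rightarrow> 'b::real_normed_vector) \<Rightarrow> real^'n \<Rightarrow> 'b" where
  "partial i f x = frechet_derivative f (at x) (axis i 1)"

definition grad :: "(real^'n::finite \<Rightarrow> real) \<Rightarrow> real^'n \<Rightarrow> real^'n" where
  "grad f x = (\<chi> i. partial i f x)"

definition divergence :: "(real^'n::finite \<Rightarrow> real^'n) \<Rightarrow> real^'n \<Rightarrow> real" where
  "divergence F x = (\<Sum>i\<in>UNIV. partial i (\<lambda>y. F y $ i) x)"

definition laplacian :: "(real^'n::finite \<Rightarrow> 'b::real_normed_vector) \<Rightarrow> real^'n \<Rightarrow> 'b" where
  "laplacian f x = (\<Sum>i\<in>UNIV. partial i (partial i f) x)"

definition dt :: "(real \<Rightarrow> 'a \<Rightarrow> 'b::real_normed_vector) \<Rightarrow> real \<Rightarrow> 'a \<Rightarrow> 'b" where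
  "dt f t x = vector_derivative (\<lambda>s. f s x) (at t)"

text \<open>Near each boundary point the domain is a sublevel set of a smooth function with
  nonvanishing gradient.\<close>

definition smooth_bounded_domain :: "(real^'n::finite) set \<Rightarrow> bool" where
  "smooth_bounded_domain \<Omega> \<longleftrightarrow>
     open \<Omega> \<and> \<Omega> \<noteq> {} \<and> connected \<Omega> \<and> bounded \<Omega> \<and>
     (\<forall>x\<in>frontier \<Omega>. \<exists>U g. open U \<and> x \<in> U \<and> (\<forall>k. Ck_on k g U) \<and>
        (\<forall>y\<in>U. grad g y \<noteq> 0) \<and>
        \<Omega> \<inter> U = {y\<in>U. g y < 0} \<and> frontier \<Omega> \<inter> U = {y\<in>U. g y = 0})"

text \<open>A time-dependent field on \<open>\<Omega>\<close> with initial value \<open>f0\<close>, smooth up to the boundary for positive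
  times. The initial data are not assumed to match the boundary data on \<open>frontier \<Omega>\<close>, in which
  case a solution cannot be continuous, let alone smooth, at time 0 on the boundary. So down to
  time 0 only interior continuity and local boundedness are asked for; both hold for a field that is
  smooth on \<open>{0..} \<times> closure \<Omega>\<close>.\<close>

definition smooth_evolution ::
  "(real^'n::finite) set \<Rightarrow> (real^'n \<Rightarrow> 'b::real_normed_vector) \<Rightarrow> (real \<Rightarrow> real^'n \<Rightarrow> 'b) \<Rightarrow> bool" where
  "smooth_evolution \<Omega> f0 f \<longleftrightarrow>
     smooth_on ({0<..} \<times> closure \<Omega>) (\<lambda>(t, x). f t x) \<and>
     continuous_on ({0..} \<times> \<Omega>) (\<lambda>(t, x). f t x) \<and>
     (\<forall>s. bounded ((\<lambda>(t, x). f t x) ` ({0..s} \<times> \<Omega>))) \<and>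
     (\<forall>x\<in>\<Omega>. f 0 x = f0 x)"

definition npns_solution ::
  "(real^3) set \<Rightarrow> real \<Rightarrow> real \<Rightarrow> real \<Rightarrow> real \<Rightarrow> real \<Rightarrow>
   (real^3 \<Rightarrow> real) \<Rightarrow> (real^3 \<Rightarrow> real) \<Rightarrow> (real^3 \<Rightarrow> real) \<Rightarrow>
   (real^3 \<Rightarrow> real) \<Rightarrow> (real^3 \<Rightarrow> real) \<Rightarrow> (real^3 \<Rightarrow> real^3) \<Rightarrow>
   (real \<Rightarrow> real^3 \<Rightarrow> real) \<Rightarrow> (real \<Rightarrow> real^3 \<Rightarrow> real) \<Rightarrow> (real \<Rightarrow> real^3 \<Rightarrow> real^3) \<Rightarrow>
   (real \<Rightarrow> real^3 \<Rightarrow> real) \<Rightarrow> (real \<Rightarrow> real^3 \<Rightarrow> real) \<Rightarrow> bool" where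
  "npns_solution \<Omega> D1 D2 \<epsilon> \<nu> K \<gamma>1 \<gamma>2 W c10 c20 u0 c1 c2 u \<Phi> p \<longleftrightarrow>
     smooth_evolution \<Omega> c10 c1 \<and> smooth_evolution \<Omega> c20 c2 \<and> smooth_evolution \<Omega> u0 u \<and>
     smooth_on ({0<..} \<times> closure \<Omega>) (\<lambda>(t, x). \<Phi> t x) \<and>
     smooth_on ({0<..} \<times> closure \<Omega>) (\<lambda>(t, x). p t x) \<and>
     (\<forall>t\<ge>0. \<forall>x\<in>\<Omega>. c1 t x \<ge> 0 \<and> c2 t x \<ge> 0) \<and>
     (\<forall>t>0. \<forall>x\<in>\<Omega>.
        dt c1 t x + u t x \<bullet> grad (c1 t) x =
          D1 * divergence (\<lambda>y. grad (c1 t) y + c1 t y *\<^sub>R grad (\<Phi> t) y) x \<and>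
        dt c2 t x + u t x \<bullet> grad (c2 t) x =
          D2 * divergence (\<lambda>y. grad (c2 t) y - c2 t y *\<^sub>R grad (\<Phi> t) y) x \<and>
        - \<epsilon> * laplacian (\<Phi> t) x = c1 t x - c2 t x \<and>
        dt u t x - \<nu> *\<^sub>R laplacian (u t) x + grad (p t) x =
          (- K * (c1 t x - c2 t x)) *\<^sub>R grad (\<Phi> t) x \<and>
        divergence (u t) x = 0) \<and>
     (\<forall>t>0. \<forall>x\<in>frontier \<Omega>. c1 t x = \<gamma>1 x \<and> c2 t x = \<gamma>2 x \<and> \<Phi> t x = W x \<and> u t x = 0)"

definition max_sup :: "'a set \<Rightarrow> ('a \<Rightarrow> real) \<Rightarrow> ('a \<Rightarrow> real) \<Rightarrow> real" where
  "max_sup S f g = max (SUP x\<in>S. f x) (SUP x\<in>S. g x)"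

definition min_inf :: "'a set \<Rightarrow> ('a \<Rightarrow> real) \<Rightarrow> ('a \<Rightarrow> real) \<Rightarrow> real" where
  "min_inf S f g = min (INF x\<in>S. f x) (INF x\<in>S. g x)"

end

theory Submission
  imports Defs
begin

text \<open>
  The velocity and the electric field are never estimated: both disappear from the right energy
  balance. Fix a sign \<open>\<sigma>\<close> (\<open>1\<close> for upper bounds, \<open>- 1\<close> for lower bounds) and a level \<open>k\<close> that the boundary
  data do not reach, and let \<open>e\<^sub>i = max 0 (\<sigma> * (c\<^sub>i - k))\<close>. For positive times \<open>e\<^sub>i\<close> has compact support in
  \<open>\<Omega>\<close>, so every integration by parts below is free of boundary terms. For a convex \<open>F\<close> and charge
  \<open>z\<close> the equation gives
  \<open>\<partial>\<^sub>t (F c) = div (\<dots>) - D * F'' c * \<bar>\<nabla>c\<bar>\<^sup>2 + z * D * (c * F' c - F c) * \<Delta>\<Phi>\<close>,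
  in which incompressibility has removed \<open>u\<close>. Dividing by \<open>D\<close> and adding the two species turns the last
  term into \<open>- (H c\<^sub>1 - H c\<^sub>2) * (c\<^sub>1 - c\<^sub>2) / \<epsilon>\<close> with \<open>H s = s * F' s - F s\<close>. On \<open>s \<ge> 0\<close> the function \<open>H\<close> is
  nondecreasing, because \<open>H' s = s * F'' s\<close>; this is where the nonnegativity of the concentrations
  and the Poisson equation enter, and the term is \<open>\<le> 0\<close>. With \<open>F = e\<^sup>4\<close> the energy
  \<open>y = \<integral> e\<^sub>1\<^sup>4 / D1 + e\<^sub>2\<^sup>4 / D2\<close> therefore satisfies \<open>y' \<le> - G\<close> with \<open>G = \<integral> 12 * e\<^sub>1\<^sup>2 * \<bar>\<nabla>c\<^sub>1\<bar>\<^sup>2 + 12 * e\<^sub>2\<^sup>2 * \<bar>\<nabla>c\<^sub>2\<bar>\<^sup>2\<close>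
  (lemma \<open>energy_decay\<close>). The fourth power is chosen because \<open>F\<close> is then twice continuously
  differentiable and \<open>e\<^sup>2\<close>, whose square is \<open>F\<close>, is still continuously differentiable.

  Bounds and monotonicity. An energy that vanishes at some time vanishes afterwards. Between two positive times
  this gives the monotonicity of the extrema (lemma \<open>comparison\<close>). Initial and boundary data may
  disagree at the corner, so a solution need not be continuous at time 0 on the boundary; but it is
  locally bounded, and for levels beyond the initial data the energy tends to 0 at time 0 by dominated convergence
  (lemma \<open>comparison_initial\<close>).

  Long-time behaviour. A Nash inequality (lemma \<open>nash_inequality\<close>) bounds \<open>y\<close>, up to constant factors, by \<open>r\<^sup>2 * G\<close> plus \<open>r\<^sup>-\<^sup>3\<close> times the
  square of \<open>\<integral> e\<^sub>1\<^sup>2 + e\<^sub>2\<^sup>2\<close>, for every \<open>r > 0\<close>. By Chebyshev's inequality the latter integral at a level is at most a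
  multiple of the energy at a level closer to the boundary data. Let \<open>k\<close> now be an extreme value of the
  boundary data. Along levels that move from \<open>k + \<sigma> * \<delta> / 2\<close> to
  \<open>k + \<sigma> * \<delta>\<close> De Giorgi's iteration (lemma \<open>de_giorgi_decay\<close>) then shows that the energy at the limit level
  vanishes from a time on that depends only on \<open>D1\<close>, \<open>D2\<close>, \<open>\<delta>\<close>, \<open>\<Omega>\<close> and the bounds for all times. Waiting long
  enough plays the part of the usual smallness condition on the initial energy.
\<close>

section \<open>Smoothness of time-dependent fields in the interior\<close>

lemma Ck_on_cong:
  assumes "open U" "\<And>x. x \<in> U \<Longrightarrow> f x = g x"
  shows "Ck_on k f U \<longleftrightarrow> Ck_on k g U"
  using assms(2)
proof (induction k arbitrary: f g)
  case 0
  then show ?case by (auto cong: continuous_on_cong)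
next
  case (Suc k)
  have d': "q differentiable_on U" if "p differentiable_on U" "\<And>x. x \<in> U \<Longrightarrow> p x = q x" for p q :: "'a \<Rightarrow> 'b"
    unfolding differentiable_on_def
  proof
    fix x assume "x \<in> U"
    then show "q differentiable (at x within U)"
      using that by (intro differentiable_transform_within[of p x U 1 q]) (auto simp: differentiable_on_def)
  qed
  then have d: "f differentiable_on U \<longleftrightarrow> g differentiable_on U"
    using Suc.prems by metis
  have "frechet_derivative f (at x) = frechet_derivative g (at x)"
    if "f differentiable_on U" "x \<in> U" for x
    using that Suc.prems assms(1)
    by (intro frechet_derivative_transform_within_open[of f x U g])
       (auto simp: differentiable_on_eq_differentiable_at)
  then have "f differentiable_on U \<Longrightarrow>
      Ck_on k (\<lambda>x. frechet_derivative f (at x) v) U \<longleftrightarrow> Ck_on k (\<lambda>x. frechet_derivative g (at x) v) U" for v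
    by (intro Suc.IH) auto
  then show ?case using d by auto
qed

lemma Ck_on_subset:
  assumes "Ck_on k f U" "V \<subseteq> U"
  shows "Ck_on k f V"
  using assms by (induction k arbitrary: f) (auto intro: continuous_on_subset differentiable_on_subset)

text \<open>Smoothness up to the boundary is given by local extensions that need not agree with each other,
  so interior smoothness has to be glued from neighbourhoods.\<close>
lemma Ck_on_local:
  assumes "open U" "\<And>x. x \<in> U \<Longrightarrow> \<exists>V. open V \<and> x \<in> V \<and> Ck_on k f (U \<inter> V)"
  shows "Ck_on k f U"
  using assms(2)
proof (induction k arbitrary: f)
  case 0
  then show ?case
    by (metis Ck_on.simps(1) IntI assms(1) continuous_on_eq_continuous_at continuous_at_imp_continuous_on open_Int)
next
  case (Suc k)
  have "f differentiable at x" if x: "x \<in> U" for x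
  proof -
    obtain V where "open V" "x \<in> V" "Ck_on (Suc k) f (U \<inter> V)" using Suc.prems[OF x] by blast
    then show ?thesis using x assms(1)
      by (simp add: differentiable_on_eq_differentiable_at open_Int)
  qed
  moreover have "Ck_on k (\<lambda>x. frechet_derivative f (at x) v) U" for v
  proof (rule Suc.IH)
    fix x assume "x \<in> U"
    then obtain V where "open V" "x \<in> V" "Ck_on (Suc k) f (U \<inter> V)" using Suc.prems by blast
    then show "\<exists>V. open V \<and> x \<in> V \<and> Ck_on k (\<lambda>x. frechet_derivative f (at x) v) (U \<inter> V)"
      by auto
  qed
  ultimately show ?case
    by (simp add: differentiable_on_eq_differentiable_at assms(1))
qed

lemma Ck_on_bounded_linear:
  assumes "open U" "bounded_linear L" "Ck_on k f U"
  shows "Ck_on k (\<lambda>x. L (f x)) U"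
  using assms(3)
proof (induction k arbitrary: f)
  case 0
  then show ?case by (auto intro: bounded_linear.continuous_on[OF assms(2)])
next
  case (Suc k)
  have d: "((\<lambda>x. L (f x)) has_derivative (\<lambda>v. L (frechet_derivative f (at x) v))) (at x)" if "x \<in> U" for x
    using that Suc.prems assms(1)
    by (intro bounded_linear.has_derivative[OF assms(2)])
       (auto simp: differentiable_on_eq_differentiable_at frechet_derivative_works)
  then have "(\<lambda>x. L (f x)) differentiable_on U"
    using assms(1) by (auto simp: differentiable_on_eq_differentiable_at differentiable_def)
  moreover have "Ck_on k (\<lambda>x. frechet_derivative (\<lambda>x. L (f x)) (at x) v) U" for v
  proof -
    have "Ck_on k (\<lambda>x. L (frechet_derivative f (at x) v)) U"
      using Suc by auto
    then show ?thesis
      using Ck_on_cong[OF assms(1), of "\<lambda>x. L (frechet_derivative f (at x) v)"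
          "\<lambda>x. frechet_derivative (\<lambda>x. L (f x)) (at x) v"] frechet_derivative_at[OF d] by metis
  qed
  ultimately show ?case by simp
qed

lemma smooth_on_imp_continuous_on:
  assumes "smooth_on S f"
  shows "continuous_on S f"
  unfolding continuous_on_eq_continuous_within
proof
  fix x assume x: "x \<in> S"
  then obtain U g where U: "open U" "x \<in> U" "\<forall>k. Ck_on k g U" "\<forall>y\<in>S \<inter> U. g y = f y"
    using assms unfolding smooth_on_def by blast
  have "continuous_on U g" using U(3) Ck_on.simps(1) by metis
  then have "continuous (at x within S) g"
    using U(1,2) by (simp add: continuous_on_eq_continuous_at continuous_at_imp_continuous_within)
  moreover obtain d where "d > 0" "ball x d \<subseteq> U" using U openE by blast
  ultimately show "continuous (at x within S) f"
    using U(4) x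
    by (intro continuous_transform_within[of x S g d f]) (auto simp: subset_iff dist_commute)
qed

lemma smooth_on_imp_Ck_on:
  assumes "smooth_on S f" "open V" "V \<subseteq> S"
  shows "Ck_on k f V"
proof (rule Ck_on_local[OF assms(2)])
  fix x assume "x \<in> V"
  then have "x \<in> S" using assms(3) by blast
  then obtain U g where U: "open U" "x \<in> U" "\<forall>k. Ck_on k g U" "\<forall>y\<in>S \<inter> U. g y = f y"
    using assms(1) unfolding smooth_on_def by blast
  have "Ck_on k g (V \<inter> U)" using U(3) by (intro Ck_on_subset[where U = U and V = "V \<inter> U"]) auto
  then have "Ck_on k f (V \<inter> U)"
    using Ck_on_cong[of "V \<inter> U" g f k] U(1,4) assms(2,3) by blast
  then show "\<exists>U. open U \<and> x \<in> U \<and> Ck_on k f (V \<inter> U)" using U(1,2) by blast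
qed

text \<open>Joint smoothness in time and space on the open set \<open>{0<..} \<times> \<Omega>\<close>. The class is closed under
  \<^const>\<open>partial\<close> and \<^const>\<open>dt\<close>, so one hypothesis yields all the derivatives that the equations mention,
  together with their joint continuity.\<close>
definition evolves_smoothly_on :: "(real^'n::finite) set \<Rightarrow> (real \<Rightarrow> real^'n \<Rightarrow> 'b::real_normed_vector) \<Rightarrow> bool"
  where "evolves_smoothly_on \<Omega> f \<longleftrightarrow> (\<forall>k. Ck_on k (\<lambda>(t, x). f t x) ({0<..} \<times> \<Omega>))"

lemma smooth_on_imp_evolves_smoothly_on:
  assumes "open \<Omega>" "smooth_on ({0<..} \<times> closure \<Omega>) (\<lambda>(t, x). f t x)"
  shows "evolves_smoothly_on \<Omega> f"
  unfolding evolves_smoothly_on_def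
  using assms(1) closure_subset[of \<Omega>]
  by (intro allI smooth_on_imp_Ck_on[OF assms(2)]) (auto intro: open_Times)

lemma evolves_smoothly_on_continuous:
  "evolves_smoothly_on \<Omega> f \<Longrightarrow> continuous_on ({0<..} \<times> \<Omega>) (\<lambda>(t, x). f t x)"
  unfolding evolves_smoothly_on_def using Ck_on.simps(1) by blast

lemma evolves_smoothly_on_has_derivative:
  assumes "evolves_smoothly_on \<Omega> f" "open \<Omega>" "t > 0" "x \<in> \<Omega>"
  shows "((\<lambda>(t, x). f t x) has_derivative frechet_derivative (\<lambda>(t, x). f t x) (at (t, x))) (at (t, x))"
proof -
  have "Ck_on (Suc 0) (\<lambda>(t, x). f t x) ({0<..} \<times> \<Omega>)"
    using assms(1) unfolding evolves_smoothly_on_def by blast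
  then have "(\<lambda>(t, x). f t x) differentiable_on ({0<..} \<times> \<Omega>)" by (simp only: Ck_on.simps)
  then have "(\<lambda>(t, x). f t x) differentiable at (t, x)"
    using assms by (subst (asm) differentiable_on_eq_differentiable_at) (auto intro: open_Times)
  then show ?thesis by (simp only: frechet_derivative_works)
qed

text \<open>Partial derivatives in time or in space are directional derivatives of the joint field, along
  \<open>(1, 0)\<close> and \<open>(0, axis i 1)\<close>.\<close>
lemma evolves_smoothly_on_directional:
  assumes "evolves_smoothly_on \<Omega> f" "open \<Omega>"
    "\<And>t x. t > 0 \<Longrightarrow> x \<in> \<Omega> \<Longrightarrow> g t x = frechet_derivative (\<lambda>(t, x). f t x) (at (t, x)) v"
  shows "evolves_smoothly_on \<Omega> g"
  unfolding evolves_smoothly_on_def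
proof
  fix k
  have o: "open ({0::real<..} \<times> \<Omega>)" using assms(2) by (intro open_Times open_greaterThan)
  have "Ck_on (Suc k) (\<lambda>(t, x). f t x) ({0<..} \<times> \<Omega>)"
    using assms(1) unfolding evolves_smoothly_on_def by (rule spec)
  then have "Ck_on k (\<lambda>z. frechet_derivative (\<lambda>(t, x). f t x) (at z) v) ({0<..} \<times> \<Omega>)"
    by (simp only: Ck_on.simps)
  then show "Ck_on k (\<lambda>(t, x). g t x) ({0<..} \<times> \<Omega>)"
    by (subst Ck_on_cong[OF o]) (auto simp: assms(3))
qed

lemma evolves_smoothly_on_has_derivative_space:
  assumes "evolves_smoothly_on \<Omega> f" "open \<Omega>" "t > 0" "x \<in> \<Omega>"
  shows "(f t has_derivative (\<lambda>h. frechet_derivative (\<lambda>(t, x). f t x) (at (t, x)) (0, h))) (at x)"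
proof -
  have "((\<lambda>y. (t, y)) has_derivative (\<lambda>h. (0, h))) (at x)"
    by (auto intro!: derivative_eq_intros)
  from diff_chain_at[OF this evolves_smoothly_on_has_derivative[OF assms]]
  show ?thesis by (simp add: o_def)
qed

lemma evolves_smoothly_on_differentiable:
  assumes "evolves_smoothly_on \<Omega> f" "open \<Omega>" "t > 0" "x \<in> \<Omega>"
  shows "f t differentiable at x"
  using evolves_smoothly_on_has_derivative_space[OF assms] unfolding differentiable_def by blast

lemma evolves_smoothly_on_partial:
  assumes "evolves_smoothly_on \<Omega> f" "open \<Omega>"
  shows "evolves_smoothly_on \<Omega> (\<lambda>t. partial i (f t))"
proof (rule evolves_smoothly_on_directional[OF assms])
  fix t :: real and x assume "t > 0" "x \<in> \<Omega>"
  then show "partial i (f t) x = frechet_derivative (\<lambda>(t, x). f t x) (at (t, x)) (0, axis i 1)"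
    using frechet_derivative_at[OF evolves_smoothly_on_has_derivative_space[OF assms]]
    unfolding partial_def by metis
qed

lemma evolves_smoothly_on_has_vector_derivative_time:
  assumes "evolves_smoothly_on \<Omega> f" "open \<Omega>" "t > 0" "x \<in> \<Omega>"
  shows "((\<lambda>s. f s x) has_vector_derivative frechet_derivative (\<lambda>(t, x). f t x) (at (t, x)) (1, 0)) (at t)"
proof -
  let ?D = "frechet_derivative (\<lambda>(t, x). f t x) (at (t, x))"
  have "((\<lambda>s. (s, x)) has_derivative (\<lambda>h. (h, 0))) (at t)"
    by (auto intro!: derivative_eq_intros)
  from diff_chain_at[OF this evolves_smoothly_on_has_derivative[OF assms]]
  have "((\<lambda>s. f s x) has_derivative (\<lambda>h. ?D (h, 0))) (at t)"
    by (simp add: o_def)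
  moreover have "linear ?D"
    using evolves_smoothly_on_has_derivative[OF assms] has_derivative_linear by blast
  then have D: "?D (h *\<^sub>R (1, 0)) = h *\<^sub>R ?D (1, 0)" for h
    by (rule linear_scale)
  have "(\<lambda>h. ?D (h, 0)) = (\<lambda>h. h *\<^sub>R ?D (1, 0))"
  proof
    show "?D (h, 0) = h *\<^sub>R ?D (1, 0)" for h
      using D[of h] by simp
  qed
  ultimately show ?thesis unfolding has_vector_derivative_def by (simp only:)
qed

lemma evolves_smoothly_on_dt:
  assumes "evolves_smoothly_on \<Omega> f" "open \<Omega>"
  shows "evolves_smoothly_on \<Omega> (dt f)"
  by (rule evolves_smoothly_on_directional[OF assms], unfold dt_def)
     (rule vector_derivative_at, rule evolves_smoothly_on_has_vector_derivative_time[OF assms])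

lemma evolves_smoothly_on_DERIV_time:
  fixes f :: "real \<Rightarrow> real^'n::finite \<Rightarrow> real"
  assumes "evolves_smoothly_on \<Omega> f" "open \<Omega>" "t > 0" "x \<in> \<Omega>"
  shows "((\<lambda>s. f s x) has_real_derivative dt f t x) (at t)"
  using evolves_smoothly_on_has_vector_derivative_time[OF assms]
    vector_derivative_at[OF evolves_smoothly_on_has_vector_derivative_time[OF assms]]
  by (simp add: dt_def has_real_derivative_iff_has_vector_derivative)

lemma evolves_smoothly_on_component:
  fixes f :: "real \<Rightarrow> real^'n::finite \<Rightarrow> real^'m::finite"
  assumes "evolves_smoothly_on \<Omega> f" "open \<Omega>"
  shows "evolves_smoothly_on \<Omega> (\<lambda>t x. f t x $ i)"
  using assms Ck_on_bounded_linear[OF _ bounded_linear_vec_nth, of "{0<..} \<times> \<Omega>" _ "\<lambda>(t, x). f t x" i]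
  unfolding evolves_smoothly_on_def by (auto simp: split_def open_Times)

lemma has_derivative_grad:
  fixes f :: "real^'n::finite \<Rightarrow> real"
  assumes "f differentiable at x"
  shows "(f has_derivative (\<lambda>h. h \<bullet> grad f x)) (at x)"
proof -
  let ?D = "frechet_derivative f (at x)"
  have D: "(f has_derivative ?D) (at x)" using assms frechet_derivative_works by blast
  have "?D h = h \<bullet> grad f x" for h
  proof -
    have "?D h = ?D (\<Sum>i\<in>UNIV. (h $ i) *\<^sub>R axis i 1)"
      using basis_expansion[of h] by (simp add: scalar_mult_eq_scaleR)
    also have "\<dots> = (\<Sum>i\<in>UNIV. h $ i * ?D (axis i 1))"
      using has_derivative_linear[OF D] by (simp add: linear_sum linear_scale)
    finally show ?thesis by (simp add: inner_vec_def grad_def partial_def)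
  qed
  then show ?thesis using D by presburger
qed

text \<open>Restricting to lines reduces the computation of divergences to calculus in one real variable.\<close>
lemma DERIV_partial:
  fixes f :: "real^'n::finite \<Rightarrow> real"
  assumes "f differentiable at x"
  shows "((\<lambda>s. f (x + s *\<^sub>R axis i 1)) has_real_derivative partial i f x) (at 0)"
proof -
  have "((\<lambda>s. x + s *\<^sub>R axis i 1) has_derivative (\<lambda>s. s *\<^sub>R axis i 1)) (at (0::real))"
    by (auto intro!: derivative_eq_intros)
  moreover have "(f has_derivative (\<lambda>h. h \<bullet> grad f x)) (at (x + 0 *\<^sub>R axis i 1))"
    using has_derivative_grad[OF assms] by simp
  ultimately have "((\<lambda>s. f (x + s *\<^sub>R axis i 1)) has_derivative (\<lambda>s. (s *\<^sub>R axis i 1) \<bullet> grad f x)) (at 0)"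
    by (rule has_derivative_compose)
  then show ?thesis
    by (simp add: has_field_derivative_def inner_axis' grad_def mult.commute[of _ "partial i f x"])
qed

lemma partial_eqI:
  fixes f :: "real^'n::finite \<Rightarrow> real"
  assumes "f differentiable at x"
    "((\<lambda>s. f (x + s *\<^sub>R axis i 1)) has_real_derivative D) (at 0)"
  shows "partial i f x = D"
  using DERIV_unique[OF DERIV_partial[OF assms(1)] assms(2)] .

lemma evolves_smoothly_on_continuous_space:
  assumes "evolves_smoothly_on \<Omega> f" "t > 0"
  shows "continuous_on \<Omega> (f t)"
proof -
  have "continuous_on \<Omega> (\<lambda>x. (t, x))" by (intro continuous_on_Pair continuous_on_const continuous_on_id)
  from continuous_on_compose2[OF evolves_smoothly_on_continuous[OF assms(1)] this] show ?thesis
    using assms(2) by auto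
qed

lemma evolves_smoothly_on_partial_regularity:
  assumes "evolves_smoothly_on \<Omega> f" "open \<Omega>" "t > 0"
  shows "continuous_on \<Omega> (partial i (f t))" "continuous_on \<Omega> (partial j (partial i (f t)))"
    "x \<in> \<Omega> \<Longrightarrow> f t differentiable at x" "x \<in> \<Omega> \<Longrightarrow> partial i (f t) differentiable at x"
proof -
  note p = evolves_smoothly_on_partial[OF assms(1,2), of i]
  show "continuous_on \<Omega> (partial i (f t))"
    by (rule evolves_smoothly_on_continuous_space[OF p assms(3)])
  show "continuous_on \<Omega> (partial j (partial i (f t)))"
    by (rule evolves_smoothly_on_continuous_space[OF evolves_smoothly_on_partial[OF p assms(2)] assms(3)])
  show "f t differentiable at x" if "x \<in> \<Omega>"
    by (rule evolves_smoothly_on_differentiable[OF assms that])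
  show "partial i (f t) differentiable at x" if "x \<in> \<Omega>"
    by (rule evolves_smoothly_on_differentiable[OF p assms(2,3) that])
qed

section \<open>Integrals of functions with bounded support\<close>

lemma integrable_continuous_bounded_support:
  fixes f :: "'a::euclidean_space \<Rightarrow> real"
  assumes "continuous_on UNIV f" "bounded K" "\<And>x. x \<notin> K \<Longrightarrow> f x = 0"
  shows "integrable lborel f"
proof -
  have "compact (closure K)" using assms(2) by simp
  then have "integrable lborel (\<lambda>x. indicator (closure K) x *\<^sub>R f x)"
    by (rule borel_integrable_compact) (use assms(1) continuous_on_subset in blast)
  moreover have "(\<lambda>x. indicator (closure K) x *\<^sub>R f x) = f"
    using assms(3) closure_subset by (fastforce simp: indicator_def)
  ultimately show ?thesis by simp
qed

text \<open>A common bounded support makes the integrals integrals over a box, where continuity of the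
  derivative suffices. The time derivative of the energy, the divergence theorem and the Nash
  inequality all rest on it.\<close>
lemma leibniz_bounded_support:
  fixes f f' :: "real \<Rightarrow> 'a::euclidean_space \<Rightarrow> real"
  assumes U: "open U" "convex U" "s0 \<in> U"
    and K: "bounded K" "\<And>s x. s \<in> U \<Longrightarrow> x \<notin> K \<Longrightarrow> f s x = 0"
    and f: "\<And>s. s \<in> U \<Longrightarrow> continuous_on UNIV (f s)"
    and f': "continuous_on (U \<times> UNIV) (\<lambda>(s, x). f' s x)"
    and D: "\<And>s x. s \<in> U \<Longrightarrow> ((\<lambda>s. f s x) has_real_derivative f' s x) (at s)"
  shows "((\<lambda>s. LINT x|lborel. f s x) has_real_derivative (LINT x|lborel. f' s0 x)) (at s0)"
proof -
  obtain a where a: "K \<subseteq> cbox (-a) a" using bounded_subset_cbox_symmetric[OF K(1)] by blast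
  \<comment> \<open>\<open>U\<close> is open, so outside \<open>K\<close> the function vanishes for all nearby parameters as well.\<close>
  have f'0: "f' s x = 0" if "s \<in> U" "x \<notin> K" for s x
  proof -
    have "((\<lambda>s. f s x) has_real_derivative 0) (at s)"
      using that U(1) K(2) by (intro has_field_derivative_transform_within_open[OF DERIV_const[of 0], of U]) auto
    then show ?thesis using D[OF that(1)] DERIV_unique by blast
  qed
  have LI: "(LINT x|lborel. g x) = integral (cbox (-a) a) g"
    if g: "continuous_on UNIV g" "\<And>x. x \<notin> K \<Longrightarrow> g x = 0" for g :: "'a \<Rightarrow> real"
  proof -
    have "(LINT x|lborel. g x) = integral UNIV g"
      by (rule integral_lborel[symmetric]) (use g K integrable_continuous_bounded_support in blast)
    also have "\<dots> = integral (cbox (-a) a) g"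
    proof -
      have "(\<lambda>x. if x \<in> cbox (-a) a then g x else 0) = g"
      proof
        fix x show "(if x \<in> cbox (-a) a then g x else 0) = g x"
          using g(2)[of x] a by (cases "x \<in> K") (simp_all add: subsetD)
      qed
      then show ?thesis using integral_restrict_UNIV[of "cbox (-a) a" g] by simp
    qed
    finally show ?thesis .
  qed
  have cf': "continuous_on UNIV (f' s)" if "s \<in> U" for s
  proof -
    have "continuous_on UNIV (\<lambda>x::'a. (s, x))" by (intro continuous_on_Pair continuous_on_const continuous_on_id)
    then show ?thesis using continuous_on_compose2[OF f', of UNIV "\<lambda>x. (s, x)"] that by auto
  qed
  have f'I: "(LINT x|lborel. f' s0 x) = integral (cbox (-a) a) (f' s0)"
    by (rule LI[OF cf'[OF U(3)]]) (rule f'0[OF U(3)])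
  have "((\<lambda>s. integral (cbox (-a) a) (f s)) has_field_derivative integral (cbox (-a) a) (f' s0)) (at s0 within U)"
  proof (rule leibniz_rule_field_derivative)
    show "continuous_on (U \<times> cbox (- a) a) (\<lambda>(s, x). f' s x)"
      using f' by (rule continuous_on_subset) auto
    show "f s integrable_on cbox (- a) a" if "s \<in> U" for s
      by (rule integrable_continuous, rule continuous_on_subset[OF f[OF that]]) simp
  qed (use U in \<open>simp_all add: has_field_derivative_at_within[OF D]\<close>)
  then have "((\<lambda>s. integral (cbox (-a) a) (f s)) has_field_derivative (LINT x|lborel. f' s0 x)) (at s0)"
    by (simp only: f'I at_within_open[OF U(3,1)])
  then show ?thesis
    by (rule has_field_derivative_transform_within_open[OF _ U(1,3)]) (use LI f K in auto)
qed

lemma lborel_integral_translate: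
  fixes f :: "'a::euclidean_space \<Rightarrow> real"
  assumes "f \<in> borel_measurable borel"
  shows "(LINT x|lborel. f (x + h)) = (LINT x|lborel. f x)"
proof -
  have "(LINT x|lborel. f x) = (LINT x|distr lborel borel (\<lambda>x. h + x). f x)"
    using lborel_distr_plus[of h] by simp
  also have "\<dots> = (LINT x|lborel. f (h + x))"
    by (rule integral_distr) (use assms in auto)
  finally show ?thesis by (simp add: add.commute)
qed

lemma bounded_translates:
  fixes K :: "'a::real_normed_vector set"
  assumes "bounded K"
  shows "bounded {x. \<exists>s::real. \<bar>s\<bar> \<le> B \<and> x + s *\<^sub>R h \<in> K}"
proof -
  obtain b where b: "\<And>x. x \<in> K \<Longrightarrow> norm x \<le> b" using assms bounded_iff by blast
  show ?thesis
  proof (rule boundedI)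
    fix x assume "x \<in> {x. \<exists>s. \<bar>s\<bar> \<le> B \<and> x + s *\<^sub>R h \<in> K}"
    then obtain s where s: "\<bar>s\<bar> \<le> B" "x + s *\<^sub>R h \<in> K" by blast
    have "norm x \<le> norm (x + s *\<^sub>R h) + norm (s *\<^sub>R h)"
      by (metis add_diff_cancel_right' norm_triangle_ineq4)
    also have "\<dots> \<le> b + B * norm h" using b[OF s(2)] mult_right_mono[OF s(1) norm_ge_zero[of h]] by simp
    finally show "norm x \<le> b + B * norm h" .
  qed
qed

text \<open>The divergence theorem for compactly supported fields, one coordinate at a time: the integral
  of a translate does not depend on the translation.\<close>
lemma integral_directional_derivative_eq_0:
  fixes f g :: "'a::euclidean_space \<Rightarrow> real"
  assumes K: "bounded K" "\<And>x. x \<notin> K \<Longrightarrow> f x = 0"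
    and cont: "continuous_on UNIV f" "continuous_on UNIV g"
    and D: "\<And>x. ((\<lambda>s. f (x + s *\<^sub>R h)) has_real_derivative g x) (at 0)"
  shows "(LINT x|lborel. g x) = 0"
proof -
  have D': "((\<lambda>s. f (x + s *\<^sub>R h)) has_real_derivative g (x + s *\<^sub>R h)) (at s)" for x s
    using D[of "x + s *\<^sub>R h"] DERIV_at_within_shift[of "\<lambda>s. f (x + s *\<^sub>R h)" "g (x + s *\<^sub>R h)" s 0 UNIV]
    by (simp add: algebra_simps)
  have "((\<lambda>s. LINT x|lborel. f (x + s *\<^sub>R h)) has_real_derivative (LINT x|lborel. g (x + 0 *\<^sub>R h))) (at 0)"
  proof (rule leibniz_bounded_support[of "{-1<..<1}" _ "{x. \<exists>s. \<bar>s\<bar> \<le> 1 \<and> x + s *\<^sub>R h \<in> K}"])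
    show "bounded {x. \<exists>s. \<bar>s\<bar> \<le> 1 \<and> x + s *\<^sub>R h \<in> K}" by (rule bounded_translates[OF K(1)])
    show "continuous_on UNIV (\<lambda>x. f (x + s *\<^sub>R h))" for s
      by (rule continuous_on_compose2[OF cont(1)]) (auto intro!: continuous_intros)
    show "continuous_on ({-1<..<1} \<times> UNIV) (\<lambda>(s, x). g (x + s *\<^sub>R h))"
      unfolding split_def by (rule continuous_on_compose2[OF cont(2)]) (auto intro!: continuous_intros)
  qed (use D' K(2) in \<open>auto simp: abs_le_iff\<close>)
  moreover have "(LINT x|lborel. f (x + s *\<^sub>R h)) = (LINT x|lborel. f x)" for s
    by (rule lborel_integral_translate) (use cont in \<open>auto intro: borel_measurable_continuous_onI\<close>)
  ultimately show ?thesis using DERIV_unique[OF _ DERIV_const] by simp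
qed

text \<open>A nonempty open set is not a null set.\<close>
lemma continuous_nonneg_integral_eq_0:
  fixes f :: "'a::euclidean_space \<Rightarrow> real"
  assumes "continuous_on UNIV f" "integrable lborel f" "\<And>x. f x \<ge> 0" "(LINT x|lborel. f x) = 0"
  shows "f x = 0"
proof -
  have "AE x in lborel. f x = 0"
    using integral_nonneg_eq_0_iff_AE[OF assms(2)] assms(3,4) by simp
  moreover have o: "open {x. f x \<noteq> 0}"
    using assms(1) by (intro open_Collect_neq) (auto intro: continuous_on_const)
  ultimately have "{x. f x \<noteq> 0} \<in> null_sets lborel"
    by (subst AE_iff_null_sets) auto
  then have "negligible {x. f x \<noteq> 0}"
    by (simp add: negligible_iff_null_sets null_sets_completionI)
  with o have "{x. f x \<noteq> 0} = {}" using open_not_negligible by blast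
  then show ?thesis by blast
qed

definition extend_zero :: "'a set \<Rightarrow> ('a \<Rightarrow> real) \<Rightarrow> 'a \<Rightarrow> real" where
  "extend_zero \<Omega> f x = (if x \<in> \<Omega> then f x else 0)"

text \<open>Integrands live on \<open>\<Omega>\<close> only. If they vanish outside a compact part of \<open>\<Omega>\<close>, their extension by zero
  is as regular as they are, because \<open>\<Omega>\<close> and the complement of that part are two open sets that
  cover the space.\<close>
lemma continuous_on_extend_zero_family:
  fixes \<Omega> K :: "'a::topological_space set" and U :: "'c::topological_space set"
  assumes "open U" "open \<Omega>" "closed K" "K \<subseteq> \<Omega>"
    and cont: "continuous_on (U \<times> \<Omega>) (\<lambda>(s, x). f s x)"
    and zero: "\<And>s x. s \<in> U \<Longrightarrow> x \<in> \<Omega> - K \<Longrightarrow> f s x = 0"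
  shows "continuous_on (U \<times> UNIV) (\<lambda>(s, x). extend_zero \<Omega> (f s) x)"
proof -
  have "continuous_on (U \<times> \<Omega>) (\<lambda>(s, x). extend_zero \<Omega> (f s) x)"
    by (rule continuous_on_eq[OF cont]) (auto simp: extend_zero_def)
  moreover have "continuous_on (U \<times> (- K)) (\<lambda>(s, x). extend_zero \<Omega> (f s) x)"
    by (rule continuous_on_eq[OF continuous_on_const[of _ 0]]) (use zero in \<open>auto simp: extend_zero_def\<close>)
  ultimately have "continuous_on (U \<times> \<Omega> \<union> U \<times> (- K)) (\<lambda>(s, x). extend_zero \<Omega> (f s) x)"
    using assms(1-3) by (intro continuous_on_open_Un open_Times) auto
  moreover have "U \<times> \<Omega> \<union> U \<times> (- K) = U \<times> UNIV" using assms(4) by blast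
  ultimately show ?thesis by simp
qed

lemma continuous_on_extend_zero:
  assumes "open \<Omega>" "closed K" "K \<subseteq> \<Omega>" "continuous_on \<Omega> f" "\<And>x. x \<in> \<Omega> - K \<Longrightarrow> f x = 0"
  shows "continuous_on UNIV (extend_zero \<Omega> f)"
proof -
  have "continuous_on (UNIV \<times> \<Omega>) (\<lambda>(s :: real, x). f x)"
    unfolding split_def by (rule continuous_on_compose2[OF assms(4)]) (auto intro: continuous_on_snd)
  then have "continuous_on (UNIV \<times> UNIV) (\<lambda>(s :: real, x). extend_zero \<Omega> f x)"
    using assms by (intro continuous_on_extend_zero_family[of UNIV \<Omega> K "\<lambda>_. f"]) auto
  from continuous_on_compose2[OF this, of UNIV "\<lambda>x. (0 :: real, x)"] show ?thesis
    by (simp add: continuous_on_Pair continuous_on_const continuous_on_id)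
qed

lemma integrable_extend_zero:
  fixes \<Omega> :: "'a::euclidean_space set"
  assumes "open \<Omega>" "compact K" "K \<subseteq> \<Omega>" "continuous_on \<Omega> f" "\<And>x. x \<in> \<Omega> - K \<Longrightarrow> f x = 0"
  shows "integrable lborel (extend_zero \<Omega> f)"
proof (rule integrable_continuous_bounded_support)
  show "continuous_on UNIV (extend_zero \<Omega> f)"
    using assms compact_imp_closed by (intro continuous_on_extend_zero[of \<Omega> K]) auto
  show "bounded K" using assms(2) by (rule compact_imp_bounded)
  show "extend_zero \<Omega> f x = 0" if "x \<notin> K" for x using that assms(5) by (auto simp: extend_zero_def)
qed

lemma integral_extend_zero_directional_derivative:
  fixes \<Omega> :: "'a::euclidean_space set"
  assumes \<Omega>: "open \<Omega>" and K: "compact K" "K \<subseteq> \<Omega>"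
    and f: "continuous_on \<Omega> f" "\<And>x. x \<in> \<Omega> - K \<Longrightarrow> f x = 0"
    and g: "continuous_on \<Omega> g" "\<And>x. x \<in> \<Omega> - K \<Longrightarrow> g x = 0"
    and D: "\<And>x. x \<in> \<Omega> \<Longrightarrow> ((\<lambda>s. f (x + s *\<^sub>R h)) has_real_derivative g x) (at 0)"
  shows "(LINT x|lborel. extend_zero \<Omega> g x) = 0"
proof (rule integral_directional_derivative_eq_0)
  have K': "closed K" using K(1) by (rule compact_imp_closed)
  show "bounded K" using K(1) by (rule compact_imp_bounded)
  show "extend_zero \<Omega> f x = 0" if "x \<notin> K" for x using that f(2) by (auto simp: extend_zero_def)
  show "continuous_on UNIV (extend_zero \<Omega> f)" by (rule continuous_on_extend_zero[OF \<Omega> K' K(2) f])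
  show "continuous_on UNIV (extend_zero \<Omega> g)" by (rule continuous_on_extend_zero[OF \<Omega> K' K(2) g])
  show "((\<lambda>s. extend_zero \<Omega> f (x + s *\<^sub>R h)) has_real_derivative extend_zero \<Omega> g x) (at 0)" for x
  proof -
    have line: "open ((\<lambda>s. x + s *\<^sub>R h) -` S)" if "open S" for S
      by (rule open_vimage[OF that]) (intro continuous_intros)
    show ?thesis
    proof (cases "x \<in> \<Omega>")
      case True
      then have "((\<lambda>s. f (x + s *\<^sub>R h)) has_real_derivative extend_zero \<Omega> g x) (at 0)"
        using D by (simp add: extend_zero_def)
      then show ?thesis
        by (rule has_field_derivative_transform_within_open[OF _ line[OF \<Omega>]])
           (use True in \<open>auto simp: extend_zero_def\<close>)
    next
      case False
      then have "((\<lambda>s. 0) has_real_derivative extend_zero \<Omega> g x) (at 0)"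
        by (simp add: extend_zero_def)
      then show ?thesis
        by (rule has_field_derivative_transform_within_open[OF _ line[of "- K"]])
           (use False K K' f(2) in \<open>auto simp: extend_zero_def\<close>)
    qed
  qed
qed

lemma has_derivative_extend_zero:
  fixes f :: "'a::euclidean_space \<Rightarrow> real"
  assumes "open \<Omega>" "closed K" "K \<subseteq> \<Omega>" "\<And>x. x \<in> \<Omega> - K \<Longrightarrow> f x = 0"
    and D: "\<And>x. x \<in> \<Omega> \<Longrightarrow> (f has_derivative (\<lambda>h. h \<bullet> g x)) (at x)"
  shows "(extend_zero \<Omega> f has_derivative (\<lambda>h. h \<bullet> (if x \<in> \<Omega> then g x else 0))) (at x)"
proof (cases "x \<in> \<Omega>")
  case True
  then have "(f has_derivative (\<lambda>h. h \<bullet> (if x \<in> \<Omega> then g x else 0))) (at x)" using D by simp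
  then show ?thesis
    by (rule has_derivative_transform_within_open[OF _ assms(1) True]) (simp add: extend_zero_def)
next
  case False
  have "((\<lambda>x. 0) has_derivative (\<lambda>h. h \<bullet> (if x \<in> \<Omega> then g x else 0))) (at x)" using False by simp
  moreover have "open (- K)" "x \<in> - K" using assms False by auto
  ultimately show ?thesis
    by (rule has_derivative_transform_within_open) (use assms(4) in \<open>auto simp: extend_zero_def\<close>)
qed

section \<open>A Nash inequality\<close>

text \<open>The correlation \<open>\<integral> f x * f (x + s *\<^sub>R h)\<close> changes along \<open>s \<in> {0..1}\<close> at a rate that is at most
  \<open>(\<integral> f\<^sup>2 + (norm h)\<^sup>2 * \<integral> \<bar>g\<bar>\<^sup>2) / 2\<close>, by Young's inequality; here \<open>g\<close> is the gradient of \<open>f\<close>.\<close>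
lemma integral_square_le_correlation:
  fixes f :: "'a::euclidean_space \<Rightarrow> real" and g :: "'a \<Rightarrow> 'a"
  assumes K: "bounded K" "\<And>x. x \<notin> K \<Longrightarrow> f x = 0" "\<And>x. x \<notin> K \<Longrightarrow> g x = 0"
    and g: "continuous_on UNIV g"
    and D: "\<And>x. (f has_derivative (\<lambda>h. h \<bullet> g x)) (at x)"
  shows "(LINT x|lborel. (f x)\<^sup>2) \<le>
           2 * (LINT x|lborel. f x * f (x + h)) + (norm h)\<^sup>2 * (LINT x|lborel. g x \<bullet> g x)"
proof -
  have f: "continuous_on UNIV f"
    using D has_derivative_continuous by (blast intro: continuous_at_imp_continuous_on)
  have fs: "continuous_on UNIV (\<lambda>x. f (x + s *\<^sub>R h))" and gs: "continuous_on UNIV (\<lambda>x. g (x + s *\<^sub>R h))" for s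
    by (rule continuous_on_compose2[OF f] continuous_on_compose2[OF g]; auto intro!: continuous_intros)+
  let ?A = "\<lambda>s. LINT x|lborel. f x * f (x + s *\<^sub>R h)"
  let ?A' = "\<lambda>s. LINT x|lborel. f x * (h \<bullet> g (x + s *\<^sub>R h))"
  have "(?A has_real_derivative ?A' s) (at s)" for s
  proof (rule leibniz_bounded_support[of UNIV _ K])
    have "((\<lambda>s. x + s *\<^sub>R h) has_derivative (\<lambda>u. u *\<^sub>R h)) (at s)" for x s
      by (auto intro!: derivative_eq_intros)
    from diff_chain_at[OF this D]
    have "((\<lambda>s. f (x + s *\<^sub>R h)) has_derivative (\<lambda>u. u * (h \<bullet> g (x + s *\<^sub>R h)))) (at s)" for x s
      by (simp add: o_def)
    then show "((\<lambda>s. f x * f (x + s *\<^sub>R h)) has_real_derivative f x * (h \<bullet> g (x + s *\<^sub>R h))) (at s)" for x s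
      by (intro DERIV_cmult) (simp add: has_field_derivative_def mult.commute[of _ "h \<bullet> _"])
    show "continuous_on (UNIV \<times> UNIV) (\<lambda>(s, x). f x * (h \<bullet> g (x + s *\<^sub>R h)))"
      unfolding split_def
      by (intro continuous_intros continuous_on_compose2[OF f] continuous_on_compose2[OF g]) auto
  qed (use K fs f in \<open>auto intro!: continuous_intros\<close>)
  then obtain s where s: "?A 1 - ?A 0 = ?A' s"
    using MVT2[of 0 1 ?A ?A'] by auto
  have i1: "integrable lborel (\<lambda>x. (f x)\<^sup>2)"
    by (rule integrable_continuous_bounded_support[OF _ K(1)]) (use K f in \<open>auto intro!: continuous_intros\<close>)
  have i2: "integrable lborel (\<lambda>x. g (x + s *\<^sub>R h) \<bullet> g (x + s *\<^sub>R h))"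
    by (rule integrable_continuous_bounded_support[OF _ bounded_translates[OF K(1), of "\<bar>s\<bar>" h]])
       (use K gs in \<open>auto intro!: continuous_intros\<close>)
  have i3: "integrable lborel (\<lambda>x. f x * (h \<bullet> g (x + s *\<^sub>R h)))"
    by (rule integrable_continuous_bounded_support[OF _ K(1)]) (use K f gs in \<open>auto intro!: continuous_intros\<close>)
  have "- (2 * (f x * (h \<bullet> g (x + s *\<^sub>R h)))) \<le> (f x)\<^sup>2 + (norm h)\<^sup>2 * (g (x + s *\<^sub>R h) \<bullet> g (x + s *\<^sub>R h))" for x
  proof -
    have "(h \<bullet> g (x + s *\<^sub>R h))\<^sup>2 \<le> (norm h)\<^sup>2 * (g (x + s *\<^sub>R h) \<bullet> g (x + s *\<^sub>R h))"
      using Cauchy_Schwarz_ineq[of h "g (x + s *\<^sub>R h)"] by (simp add: power2_norm_eq_inner)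
    moreover have "0 \<le> (f x + h \<bullet> g (x + s *\<^sub>R h))\<^sup>2" by simp
    ultimately show ?thesis by (simp add: power2_sum)
  qed
  then have "(LINT x|lborel. - (2 * (f x * (h \<bullet> g (x + s *\<^sub>R h))))) \<le>
      (LINT x|lborel. (f x)\<^sup>2 + (norm h)\<^sup>2 * (g (x + s *\<^sub>R h) \<bullet> g (x + s *\<^sub>R h)))"
    using i1 i2 i3 by (intro integral_mono) auto
  also have "\<dots> = (LINT x|lborel. (f x)\<^sup>2) + (norm h)\<^sup>2 * (LINT x|lborel. g (x + s *\<^sub>R h) \<bullet> g (x + s *\<^sub>R h))"
    using i1 i2 by simp
  also have "(LINT x|lborel. g (x + s *\<^sub>R h) \<bullet> g (x + s *\<^sub>R h)) = (LINT x|lborel. g x \<bullet> g x)"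
    by (rule lborel_integral_translate[of "\<lambda>x. g x \<bullet> g x"])
       (use g in \<open>auto intro!: borel_measurable_continuous_onI continuous_intros\<close>)
  finally have "- 2 * ?A' s \<le> (LINT x|lborel. (f x)\<^sup>2) + (norm h)\<^sup>2 * (LINT x|lborel. g x \<bullet> g x)"
    by simp
  then show ?thesis using s by (simp add: power2_eq_square)
qed

text \<open>Average the previous bound over all shifts \<open>h\<close> in a cube of side \<open>r\<close>. By Tonelli's theorem the correlations
  integrate to at most \<open>(\<integral> f)\<^sup>2\<close>, while \<open>(norm h)\<^sup>2 \<le> DIM('a) * r\<^sup>2\<close> on the cube.\<close>
lemma nash_inequality:
  fixes f :: "'a::euclidean_space \<Rightarrow> real" and g :: "'a \<Rightarrow> 'a" and r :: real
  assumes K: "bounded K" "\<And>x. x \<notin> K \<Longrightarrow> f x = 0" "\<And>x. x \<notin> K \<Longrightarrow> g x = 0"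
    and g: "continuous_on UNIV g"
    and D: "\<And>x. (f has_derivative (\<lambda>h. h \<bullet> g x)) (at x)"
    and nonneg: "\<And>x. f x \<ge> 0" and r: "r > 0"
  shows "r ^ DIM('a) * (LINT x|lborel. (f x)\<^sup>2) \<le>
           2 * (LINT x|lborel. f x)\<^sup>2 + DIM('a) * r ^ (DIM('a) + 2) * (LINT x|lborel. g x \<bullet> g x)"
proof -
  let ?n = "DIM('a)" and ?C = "cbox 0 (r *\<^sub>R One) :: 'a set"
  \<comment> \<open>a lower bound for the correlation that holds for all shifts in the cube\<close>
  define c where "c = ((LINT x|lborel. (f x)\<^sup>2) - ?n * r\<^sup>2 * (LINT x|lborel. g x \<bullet> g x)) / 2"
  have f: "continuous_on UNIV f"
  proof (rule continuous_at_imp_continuous_on, rule ballI)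
    show "continuous (at x) f" for x by (rule has_derivative_continuous) (rule D)
  qed
  then have [measurable]: "f \<in> borel_measurable borel" by (rule borel_measurable_continuous_onI)
  have fi: "integrable lborel f" by (rule integrable_continuous_bounded_support[OF f K(1,2)])
  have g0: "(LINT x|lborel. g x \<bullet> g x) \<ge> 0" by (rule Bochner_Integration.integral_nonneg) auto
  have fh: "integrable lborel (\<lambda>x. f x * f (x + h))" for h
    by (rule integrable_continuous_bounded_support[OF _ K(1)])
       (use K in \<open>auto intro!: continuous_intros continuous_on_compose2[OF f]\<close>)
  have low: "c \<le> (LINT x|lborel. f x * f (x + h))" if "h \<in> ?C" for h
  proof -
    have "(norm h)\<^sup>2 = (\<Sum>b\<in>Basis. (h \<bullet> b)\<^sup>2)"
      unfolding power2_norm_eq_inner by (subst euclidean_inner) (simp add: power2_eq_square)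
    also have "\<dots> \<le> (\<Sum>b\<in>(Basis::'a set). r\<^sup>2)"
      using that by (intro sum_mono power_mono) (auto simp: mem_box)
    finally have "(norm h)\<^sup>2 \<le> ?n * r\<^sup>2" by simp
    then have "(norm h)\<^sup>2 * (LINT x|lborel. g x \<bullet> g x) \<le> ?n * r\<^sup>2 * (LINT x|lborel. g x \<bullet> g x)"
      using g0 by (rule mult_right_mono)
    then show ?thesis
      using integral_square_le_correlation[OF K g D, of h] by (simp add: c_def)
  qed
  have "r ^ ?n * c \<le> (LINT x|lborel. f x)\<^sup>2"
  proof (cases "c \<le> 0")
    case True
    then show ?thesis using r by (smt (verit) mult_nonneg_nonpos zero_le_power2 zero_le_power)
  next
    case False
    have "ennreal (c * r ^ ?n) = ennreal c * emeasure lborel ?C"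
      using False r by (subst emeasure_lborel_cbox) (auto simp: ennreal_mult)
    also have "\<dots> = (\<integral>\<^sup>+h. ennreal c * indicator ?C h \<partial>lborel)"
      by (simp add: nn_integral_cmult_indicator)
    also have "\<dots> \<le> (\<integral>\<^sup>+h. (\<integral>\<^sup>+x. ennreal (f x * f (x + h)) \<partial>lborel) \<partial>lborel)"
    proof (intro nn_integral_mono)
      fix h :: 'a
      show "ennreal c * indicator ?C h \<le> (\<integral>\<^sup>+x. ennreal (f x * f (x + h)) \<partial>lborel)"
        using low[of h] nonneg
        by (subst nn_integral_eq_integral[OF fh]) (auto simp: indicator_def intro!: ennreal_leI)
    qed
    also have "\<dots> = (\<integral>\<^sup>+x. (\<integral>\<^sup>+h. ennreal (f x * f (x + h)) \<partial>lborel) \<partial>lborel)"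
      by (rule lborel_pair.Fubini') simp
    also have "\<dots> = (\<integral>\<^sup>+x. ennreal (f x) * ennreal (LINT x|lborel. f x) \<partial>lborel)"
    proof (intro nn_integral_cong)
      fix x
      have "(\<integral>\<^sup>+h. ennreal (f x * f (x + h)) \<partial>lborel) = ennreal (f x) * (\<integral>\<^sup>+h. ennreal (f (x + h)) \<partial>lborel)"
        using nonneg by (simp add: ennreal_mult nn_integral_cmult)
      also have "(\<integral>\<^sup>+h. ennreal (f (x + h)) \<partial>lborel) = (\<integral>\<^sup>+h. ennreal (f h) \<partial>distr lborel borel (\<lambda>h. x + h))"
        by (simp add: nn_integral_distr)
      also have "\<dots> = ennreal (LINT x|lborel. f x)"
        using nonneg by (simp add: lborel_distr_plus nn_integral_eq_integral fi)
      finally show "(\<integral>\<^sup>+h. ennreal (f x * f (x + h)) \<partial>lborel) = ennreal (f x) * ennreal (LINT x|lborel. f x)" .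
    qed
    also have "\<dots> = ennreal ((LINT x|lborel. f x)\<^sup>2)"
      using nonneg by (simp add: nn_integral_multc nn_integral_eq_integral[OF fi] power2_eq_square ennreal_mult)
    finally show ?thesis by (simp add: mult.commute)
  qed
  then show ?thesis unfolding c_def by (simp add: power_add power2_eq_square field_simps)
qed

section \<open>De Giorgi iteration for decaying energies\<close>

text \<open>The iteration takes steps of length \<open>\<tau> / 2 ^ j\<close> and applies the Nash inequality at the length scale
  \<open>R / 2 ^ j\<close>. Here \<open>R\<close> is large enough for the mass term, and \<open>\<tau> = 256 * L * R\<^sup>2\<close> long enough for the
  dissipation term. The steps after time 1 add up to \<open>2 * \<tau>\<close>.\<close>
definition de_giorgi_scale :: "real \<Rightarrow> real \<Rightarrow> real \<Rightarrow> real" where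
  "de_giorgi_scale L A Y = max 1 (512 * L * A\<^sup>2 * Y)"

definition de_giorgi_time :: "real \<Rightarrow> real \<Rightarrow> real \<Rightarrow> real" where
  "de_giorgi_time L A Y = 1 + 512 * L * (de_giorgi_scale L A Y)\<^sup>2"

text \<open>In a time interval of length \<open>\<tau> / 2 ^ j\<close> the energy cannot lose more than it has, so at some moment
  its dissipation is at most \<open>2 ^ j / \<tau>\<close> times the current bound on the energy. At that moment the gain estimate bounds
  the energy of the next level by 1/128 of that bound: 1/256 comes from
  either term. The ratio 128 compensates the growth \<open>16 ^ j\<close> of the Chebyshev constants and \<open>8 ^ j\<close> of the
  inverse cubed length scale, since the squared energy contributes the factor \<open>128 ^ (- 2 * j)\<close>.\<close>
lemma de_giorgi_decay:
  fixes y y' G :: "nat \<Rightarrow> real \<Rightarrow> real"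
  assumes L: "L > 0" and Y: "y 0 1 \<le> Y"
    and D: "\<And>j t. t > 0 \<Longrightarrow> (y j has_real_derivative y' j t) (at t)"
    and dissipation: "\<And>j t. t > 0 \<Longrightarrow> y' j t \<le> - G j t"
    and nonneg: "\<And>j t. y j t \<ge> 0" "\<And>j t. G j t \<ge> 0"
    and decreasing: "\<And>j t. t > 0 \<Longrightarrow> y (Suc j) t \<le> y j t"
    and gain: "\<And>j t r. t > 0 \<Longrightarrow> r > 0 \<Longrightarrow>
        y (Suc j) t \<le> L * (r\<^sup>2 * G (Suc j) t + 2 * (A * 4 ^ j * y j t)\<^sup>2 / r ^ 3)"
    and t: "t \<ge> de_giorgi_time L A Y"
  shows "y j t \<le> Y / 128 ^ j"
proof -
  define R where "R = de_giorgi_scale L A Y"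
  define \<tau> where "\<tau> = 256 * L * R\<^sup>2"
  define T where "T j = 1 + 2 * \<tau> * (1 - 1 / 2 ^ j)" for j :: nat
  have R: "R \<ge> 1" "512 * L * A\<^sup>2 * Y \<le> R" by (auto simp: R_def de_giorgi_scale_def)
  have \<tau>: "\<tau> > 0" using L R by (auto simp: \<tau>_def)
  have Y0: "Y \<ge> 0" using Y nonneg(1)[of 0 1] by linarith
  have mono: "y j t \<le> y j s" if "0 < s" "s \<le> t" for j s t
  proof (rule DERIV_nonpos_imp_nonincreasing[OF that(2)])
    fix x assume "s \<le> x" "x \<le> t"
    then have "x > 0" using that by linarith
    then show "\<exists>z. (y j has_real_derivative z) (at x) \<and> z \<le> 0"
      using D dissipation[of x j] nonneg(2)[of j x] by (intro exI[of _ "y' j x"]) auto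
  qed
  have T: "T j \<ge> 1" "T j \<le> 1 + 2 * \<tau>" "T (Suc j) - T j = \<tau> / 2 ^ j" for j
  proof -
    have "1 / 2 ^ j \<le> (1::real)" by simp
    then show "T j \<ge> 1" using \<tau> by (simp add: T_def)
    show "T j \<le> 1 + 2 * \<tau>" using \<tau> by (simp add: T_def algebra_simps)
    show "T (Suc j) - T j = \<tau> / 2 ^ j" by (simp add: T_def field_simps)
  qed
  have "y j t \<le> Y / 128 ^ j" if "t \<ge> T j" for t
    using that
  proof (induction j arbitrary: t)
    case 0
    then show ?case using mono[of 1 t 0] Y by (simp add: T_def)
  next
    case (Suc j)
    define Z where "Z = Y / 128 ^ j"
    have Z: "Z \<ge> 0" using Y0 by (simp add: Z_def)
    have gap: "T j < T (Suc j)" using T(3)[of j] \<tau> by (smt (verit) divide_pos_pos zero_less_power)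
    \<comment> \<open>the moment of small dissipation\<close>
    then obtain \<xi> where \<xi>: "T j < \<xi>" "\<xi> < T (Suc j)"
      "y (Suc j) (T (Suc j)) - y (Suc j) (T j) = (T (Suc j) - T j) * y' (Suc j) \<xi>"
      using MVT2[OF gap, of "y (Suc j)" "y' (Suc j)"] D T(1)[of j] by (metis less_le_trans zero_less_one)
    have \<xi>0: "\<xi> > 0" using \<xi> T(1)[of j] by linarith
    have "y (Suc j) (T j) \<le> Z"
      using decreasing[of "T j" j] Suc.IH[of "T j"] T(1)[of j] by (simp add: Z_def)
    then have "- Z \<le> (\<tau> / 2 ^ j) * y' (Suc j) \<xi>"
      using \<xi>(3) nonneg(1)[of "Suc j" "T (Suc j)"] by (simp add: T(3))
    then have "(\<tau> / 2 ^ j) * G (Suc j) \<xi> \<le> Z"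
      using mult_left_mono[OF dissipation[OF \<xi>0, of "Suc j"], of "\<tau> / 2 ^ j"] \<tau> by simp
    then have G: "G (Suc j) \<xi> \<le> Z * 2 ^ j / \<tau>" using \<tau> by (simp add: field_simps)
    have yj: "y j \<xi> \<le> Z" using Suc.IH[of \<xi>] \<xi> by (simp add: Z_def)
    have diffusive: "L * ((R / 2 ^ j)\<^sup>2 * (Z * 2 ^ j / \<tau>)) \<le> Z / 256"
    proof -
      have "L * ((R / 2 ^ j)\<^sup>2 * (Z * 2 ^ j / \<tau>)) = Z / 256 / 2 ^ j"
        using L R by (simp add: \<tau>_def field_simps power2_eq_square)
      also have "\<dots> \<le> Z / 256" using mult_left_mono[of 1 "2 ^ j" Z] Z by (simp add: field_simps)
      finally show ?thesis .
    qed
    have concentrated: "L * (2 * (A\<^sup>2 * (4 ^ j)\<^sup>2 * Z\<^sup>2) / (R / 2 ^ j) ^ 3) \<le> Z / 256"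
    proof -
      have "((4::real) ^ j)\<^sup>2 * (2 ^ j) ^ 3 = 128 ^ j"
        by (simp add: power_mult[symmetric] mult.commute[of j] power_mult power_mult_distrib[symmetric])
      then have "L * (2 * (A\<^sup>2 * (4 ^ j)\<^sup>2 * Z\<^sup>2) / (R / 2 ^ j) ^ 3) = 2 * L * A\<^sup>2 * (128 ^ j * Z) * Z / R ^ 3"
        by (simp add: power_divide power2_eq_square mult_ac)
      also have "128 ^ j * Z = Y" by (simp add: Z_def)
      also have "2 * L * A\<^sup>2 * Y * Z / R ^ 3 \<le> (R / 256) * Z / R ^ 3"
        using R Z by (intro divide_right_mono mult_right_mono) auto
      also have "\<dots> = Z / 256 / R\<^sup>2" using R by (simp add: field_simps power3_eq_cube power2_eq_square)
      also have "\<dots> \<le> Z / 256 / 1" using R Z by (intro divide_left_mono) (auto simp: one_le_power)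
      finally show ?thesis by simp
    qed
    have "y (Suc j) t \<le> y (Suc j) \<xi>" using mono[of \<xi> t "Suc j"] Suc.prems \<xi> \<xi>0 by simp
    also have "\<dots> \<le> L * ((R / 2 ^ j)\<^sup>2 * G (Suc j) \<xi> + 2 * (A * 4 ^ j * y j \<xi>)\<^sup>2 / (R / 2 ^ j) ^ 3)"
      using R by (intro gain \<xi>0) simp
    also have "\<dots> \<le> L * ((R / 2 ^ j)\<^sup>2 * (Z * 2 ^ j / \<tau>) + 2 * (A\<^sup>2 * (4 ^ j)\<^sup>2 * Z\<^sup>2) / (R / 2 ^ j) ^ 3)"
    proof -
      have "(A * 4 ^ j * y j \<xi>)\<^sup>2 \<le> A\<^sup>2 * (4 ^ j)\<^sup>2 * Z\<^sup>2"
        using yj nonneg(1)[of j \<xi>] by (auto simp: power_mult_distrib intro!: mult_left_mono power_mono)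
      then show ?thesis
        using G L R by (intro mult_left_mono add_mono divide_right_mono) auto
    qed
    finally have "y (Suc j) t \<le> Z / 128"
      unfolding distrib_left[of L] using diffusive concentrated by linarith
    then show ?case by (simp add: Z_def mult.commute)
  qed
  moreover have "t \<ge> T j" using t T(2)[of j] by (simp add: de_giorgi_time_def \<tau>_def R_def)
  ultimately show ?thesis .
qed

section \<open>The excess over a level\<close>

lemma DERIV_max_power:
  "((\<lambda>x. (max 0 x) ^ (n + 2)) has_real_derivative real (n + 2) * (max 0 x) ^ (n + 1)) (at (x::real))"
proof -
  consider "x > 0" | "x < 0" | "x = 0" by linarith
  then show ?thesis
  proof cases
    case 1
    have "((\<lambda>x. x ^ (n + 2)) has_real_derivative real (n + 2) * (max 0 x) ^ (n + 1)) (at x)"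
      using 1 DERIV_pow[of "n + 2" x] by simp
    then show ?thesis
      by (rule has_field_derivative_transform_within_open[of _ _ _ "{0<..}"]) (use 1 in auto)
  next
    case 2
    have "((\<lambda>x. 0) has_real_derivative real (n + 2) * (max 0 x) ^ (n + 1)) (at x)"
      using 2 by simp
    then show ?thesis
      by (rule has_field_derivative_transform_within_open[of _ _ _ "{..<0}"]) (use 2 in auto)
  next
    case 3
    have "((\<lambda>h. (max 0 h) ^ (n + 2) / h) \<longlongrightarrow> 0) (at (0::real))"
    proof (rule Lim_null_comparison)
      show "\<forall>\<^sub>F h in at 0. norm ((max 0 h) ^ (n + 2) / h) \<le> (max 0 h) ^ (n + 1)"
        by (rule always_eventually) (auto simp: max_def)
      have "isCont (\<lambda>h. (max 0 h) ^ (n + 1)) (0::real)"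
        by (intro continuous_intros)
      then show "((\<lambda>h. (max 0 h) ^ (n + 1)) \<longlongrightarrow> 0) (at (0::real))"
        by (simp add: isCont_def)
    qed
    then show ?thesis using 3 by (simp add: DERIV_def)
  qed
qed

text \<open>The sign \<open>\<sigma>\<close> treats upper and lower bounds at once: \<open>1\<close> measures how far a value exceeds \<open>k\<close>,
  \<open>- 1\<close> how far it falls below \<open>k\<close>.\<close>
definition excess :: "real \<Rightarrow> real \<Rightarrow> real \<Rightarrow> real" where
  "excess \<sigma> k s = max 0 (\<sigma> * (s - k))"

lemma excess_nonneg [simp]: "excess \<sigma> k s \<ge> 0"
  by (simp add: excess_def)

lemma DERIV_excess_power:
  "((\<lambda>s. excess \<sigma> k s ^ (n + 2)) has_real_derivative real (n + 2) * \<sigma> * excess \<sigma> k s ^ (n + 1)) (at s)"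
proof -
  have "((\<lambda>s. \<sigma> * (s - k)) has_real_derivative \<sigma>) (at s)"
    by (auto intro!: derivative_eq_intros)
  from DERIV_chain2[OF DERIV_max_power[of n] this] show ?thesis
    by (simp add: excess_def mult_ac)
qed

lemma DERIV_excess_2: "((\<lambda>s. (excess \<sigma> k s)\<^sup>2) has_real_derivative 2 * \<sigma> * excess \<sigma> k s) (at s)"
  using DERIV_excess_power[of \<sigma> k 0 s] by (simp add: numeral_2_eq_2)

lemma DERIV_excess_4: "((\<lambda>s. excess \<sigma> k s ^ 4) has_real_derivative 4 * \<sigma> * excess \<sigma> k s ^ 3) (at s)"
  using DERIV_excess_power[of \<sigma> k 2 s] by (simp add: numeral_eq_Suc)

lemma DERIV_excess_3:
  "((\<lambda>s. 4 * \<sigma> * excess \<sigma> k s ^ 3) has_real_derivative 12 * \<sigma>\<^sup>2 * (excess \<sigma> k s)\<^sup>2) (at s)"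
  using DERIV_cmult[OF DERIV_excess_power[of \<sigma> k 1 s], of "4 * \<sigma>"]
  by (simp add: numeral_eq_Suc mult_ac)

lemma continuous_on_excess [continuous_intros]:
  "continuous_on S f \<Longrightarrow> continuous_on S (\<lambda>x. excess \<sigma> k (f x))"
  unfolding excess_def by (intro continuous_intros)

text \<open>Where the excess over the shifted level is positive, the excess over \<open>k\<close> is at least \<open>d\<close>.\<close>
lemma excess_chebyshev:
  assumes "\<sigma>\<^sup>2 = 1" "d > 0"
  shows "(excess \<sigma> (k + \<sigma> * d) s)\<^sup>2 \<le> excess \<sigma> k s ^ 4 / d\<^sup>2" "excess \<sigma> (k + \<sigma> * d) s \<le> excess \<sigma> k s"
proof -
  have shift: "\<sigma> * (s - (k + \<sigma> * d)) = \<sigma> * (s - k) - d"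
    using assms(1) by (simp add: algebra_simps power2_eq_square)
  show le: "excess \<sigma> (k + \<sigma> * d) s \<le> excess \<sigma> k s"
    using assms(2) unfolding excess_def shift by simp
  show "(excess \<sigma> (k + \<sigma> * d) s)\<^sup>2 \<le> excess \<sigma> k s ^ 4 / d\<^sup>2"
  proof (cases "\<sigma> * (s - k) \<le> d")
    case True
    then show ?thesis unfolding excess_def[of \<sigma> "k + \<sigma> * d"] shift by (simp add: zero_le_divide_iff)
  next
    case False
    then have "d \<le> excess \<sigma> k s" using assms(2) by (simp add: excess_def)
    then have "(excess \<sigma> (k + \<sigma> * d) s)\<^sup>2 * d\<^sup>2 \<le> (excess \<sigma> k s)\<^sup>2 * (excess \<sigma> k s)\<^sup>2"
      using le assms(2) by (intro mult_mono power_mono) auto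
    then show ?thesis using assms(2) by (simp add: field_simps power_add[symmetric])
  qed
qed

text \<open>The function \<open>s * F' s - F s\<close> for \<open>F = e\<^sup>4\<close>. Its derivative is \<open>s * F'' s\<close>, so convexity of \<open>F\<close>
  gives monotonicity on the nonnegative half-line, for either sign.\<close>
lemma excess_entropy_mono:
  assumes "0 \<le> a" "a \<le> b"
  shows "a * (4 * \<sigma> * excess \<sigma> k a ^ 3) - excess \<sigma> k a ^ 4 \<le> b * (4 * \<sigma> * excess \<sigma> k b ^ 3) - excess \<sigma> k b ^ 4"
proof (rule DERIV_nonneg_imp_nondecreasing[OF assms(2)])
  fix s assume "a \<le> s"
  have "((\<lambda>s. s * (4 * \<sigma> * excess \<sigma> k s ^ 3) - excess \<sigma> k s ^ 4) has_real_derivative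
      s * (12 * \<sigma>\<^sup>2 * (excess \<sigma> k s)\<^sup>2)) (at s)"
    by (rule DERIV_cong[OF DERIV_diff[OF DERIV_mult[OF DERIV_ident DERIV_excess_3] DERIV_excess_4]]) simp
  moreover have "s * (12 * \<sigma>\<^sup>2 * (excess \<sigma> k s)\<^sup>2) \<ge> 0" using assms(1) \<open>a \<le> s\<close> by simp
  ultimately show "\<exists>y. ((\<lambda>s. s * (4 * \<sigma> * excess \<sigma> k s ^ 3) - excess \<sigma> k s ^ 4) has_real_derivative y) (at s) \<and> 0 \<le> y"
    by blast
qed

text \<open>The set where \<open>c\<close> reaches the level is compact in \<open>{a..b} \<times> closure \<Omega>\<close> and avoids the boundary; its
  projection serves all times in \<open>{a..b}\<close> at once.\<close>
lemma compact_excess_support: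
  fixes c :: "real \<Rightarrow> 'a::heine_borel \<Rightarrow> real"
  assumes \<Omega>: "open \<Omega>" "bounded \<Omega>"
    and c: "continuous_on ({0<..} \<times> closure \<Omega>) (\<lambda>(t, x). c t x)"
    and barrier: "\<And>t x. t > 0 \<Longrightarrow> x \<in> frontier \<Omega> \<Longrightarrow> \<sigma> * c t x < \<sigma> * k"
    and a: "a > 0"
  obtains K where "compact K" "K \<subseteq> \<Omega>" "\<And>t x. t \<in> {a..b} \<Longrightarrow> x \<in> \<Omega> - K \<Longrightarrow> excess \<sigma> k (c t x) = 0"
proof -
  let ?X = "{a..b} \<times> closure \<Omega>"
  let ?h = "\<lambda>z. \<sigma> * ((case z of (t, x) \<Rightarrow> c t x) - k)"
  define S where "S = ?X \<inter> ?h -` {0..}"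
  have X: "compact ?X" using \<Omega> by (intro compact_Times) auto
  have "continuous_on ?X (\<lambda>(t, x). c t x)"
    by (rule continuous_on_subset[OF c]) (use a in auto)
  then have "continuous_on ?X ?h"
    by (intro continuous_on_mult continuous_on_diff continuous_on_const)
  then have "closed S"
    unfolding S_def by (rule continuous_closed_preimage[OF _ compact_imp_closed[OF X] closed_atLeast])
  then have "compact (?X \<inter> S)" by (rule compact_Int_closed[OF X])
  moreover have "?X \<inter> S = S" by (auto simp: S_def)
  ultimately have S: "compact S" by simp
  show ?thesis
  proof
    show "compact (snd ` S)" using S by (intro compact_continuous_image continuous_on_snd continuous_on_id)
    show "snd ` S \<subseteq> \<Omega>"
    proof
      fix x assume "x \<in> snd ` S"
      then obtain t where t: "t \<in> {a..b}" "x \<in> closure \<Omega>" "\<sigma> * (c t x - k) \<ge> 0" by (auto simp: S_def)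
      then have "x \<notin> frontier \<Omega>" using barrier[of t x] a by (auto simp: right_diff_distrib)
      then show "x \<in> \<Omega>" using t(2) \<Omega>(1) by (simp add: frontier_def interior_open)
    qed
    show "excess \<sigma> k (c t x) = 0" if "t \<in> {a..b}" "x \<in> \<Omega> - snd ` S" for t x
    proof -
      have "(t, x) \<notin> S" using that(2) by force
      then have "\<sigma> * (c t x - k) < 0" using that closure_subset[of \<Omega>] by (auto simp: S_def)
      then show ?thesis by (simp add: excess_def)
    qed
  qed
qed

text \<open>The Nash inequality for \<open>e\<^sup>2\<close>, whose gradient has the square \<open>4 * e\<^sup>2 * \<bar>\<nabla>c\<bar>\<^sup>2\<close>; the dimension 3 turns
  the factor 4 into 12, which is the factor in the second derivative of the fourth power.\<close>
lemma excess_nash: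
  fixes c :: "real \<Rightarrow> real^3 \<Rightarrow> real"
  assumes \<Omega>: "open \<Omega>" and K: "compact K" "K \<subseteq> \<Omega>" and c: "evolves_smoothly_on \<Omega> c" and t: "t > 0"
    and zero: "\<And>x. x \<in> \<Omega> - K \<Longrightarrow> excess \<sigma> k (c t x) = 0" and \<sigma>: "\<sigma>\<^sup>2 = 1" and r: "r > 0"
  shows "(LINT x|lborel. extend_zero \<Omega> (\<lambda>x. excess \<sigma> k (c t x) ^ 4) x) \<le>
     2 * (LINT x|lborel. extend_zero \<Omega> (\<lambda>x. (excess \<sigma> k (c t x))\<^sup>2) x)\<^sup>2 / r ^ 3 +
     r\<^sup>2 * (LINT x|lborel. extend_zero \<Omega> (\<lambda>x. 12 * (excess \<sigma> k (c t x))\<^sup>2 * (grad (c t) x \<bullet> grad (c t) x)) x)"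
proof -
  let ?e = "\<lambda>x. excess \<sigma> k (c t x)"
  let ?f = "extend_zero \<Omega> (\<lambda>x. (?e x)\<^sup>2)"
  let ?g = "\<lambda>x. if x \<in> \<Omega> then (2 * \<sigma> * ?e x) *\<^sub>R grad (c t) x else 0"
  have K': "closed K" using K(1) by (rule compact_imp_closed)
  have ec: "continuous_on \<Omega> ?e"
    by (intro continuous_on_excess evolves_smoothly_on_continuous_space[OF c t])
  have D: "((\<lambda>x. (?e x)\<^sup>2) has_derivative (\<lambda>h. h \<bullet> ((2 * \<sigma> * ?e x) *\<^sub>R grad (c t) x))) (at x)" if "x \<in> \<Omega>" for x
    using has_derivative_compose[OF has_derivative_grad[OF evolves_smoothly_on_differentiable[OF c \<Omega> t that]]
        DERIV_excess_2[of \<sigma> k "c t x", unfolded has_field_derivative_def]]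
    by (simp add: mult_ac)
  have g: "continuous_on UNIV ?g"
  proof (rule iffD2[OF continuous_on_componentwise], rule ballI)
    fix b :: "real^3" assume "b \<in> Basis"
    have "continuous_on \<Omega> (\<lambda>x. ((2 * \<sigma> * ?e x) *\<^sub>R grad (c t) x) \<bullet> b)"
      unfolding grad_def
      by (intro continuous_intros ec evolves_smoothly_on_partial_regularity(1)[OF c \<Omega> t])
    from continuous_on_extend_zero[OF \<Omega> K' K(2) this] zero
    have "continuous_on UNIV (extend_zero \<Omega> (\<lambda>x. ((2 * \<sigma> * ?e x) *\<^sub>R grad (c t) x) \<bullet> b))"
      by simp
    moreover have "extend_zero \<Omega> (\<lambda>x. ((2 * \<sigma> * ?e x) *\<^sub>R grad (c t) x) \<bullet> b) = (\<lambda>x. ?g x \<bullet> b)"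
      by (auto simp: extend_zero_def)
    ultimately show "continuous_on UNIV (\<lambda>x. ?g x \<bullet> b)" by simp
  qed
  have "r ^ DIM(real^3) * (LINT x|lborel. (?f x)\<^sup>2) \<le>
           2 * (LINT x|lborel. ?f x)\<^sup>2 + DIM(real^3) * r ^ (DIM(real^3) + 2) * (LINT x|lborel. ?g x \<bullet> ?g x)"
  proof (rule nash_inequality[OF compact_imp_bounded[OF K(1)] _ _ g _ _ r])
    show "?f x = 0" if "x \<notin> K" for x using zero that by (auto simp: extend_zero_def)
    show "?g x = 0" if "x \<notin> K" for x using zero[of x] that by auto
    show "(?f has_derivative (\<lambda>h. h \<bullet> ?g x)) (at x)" for x
      by (rule has_derivative_extend_zero[OF \<Omega> K' K(2) _ D]) (use zero in auto)
    show "?f x \<ge> 0" for x by (simp add: extend_zero_def)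
  qed
  moreover have "(\<lambda>x. (?f x)\<^sup>2) = extend_zero \<Omega> (\<lambda>x. ?e x ^ 4)"
    by (auto simp: extend_zero_def)
  moreover have "(LINT x|lborel. ?g x \<bullet> ?g x) =
      (LINT x|lborel. extend_zero \<Omega> (\<lambda>x. 12 * (?e x)\<^sup>2 * (grad (c t) x \<bullet> grad (c t) x)) x) / 3"
  proof -
    have "(\<lambda>x. ?g x \<bullet> ?g x) = (\<lambda>x. extend_zero \<Omega> (\<lambda>x. 12 * (?e x)\<^sup>2 * (grad (c t) x \<bullet> grad (c t) x)) x / 3)"
    proof
      fix x
      have "(2 * \<sigma> * ?e x) * (2 * \<sigma> * ?e x) = 4 * (?e x)\<^sup>2"
        using \<sigma> by (simp add: power2_eq_square)
      then show "?g x \<bullet> ?g x = extend_zero \<Omega> (\<lambda>x. 12 * (?e x)\<^sup>2 * (grad (c t) x \<bullet> grad (c t) x)) x / 3"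
        by (simp add: extend_zero_def)
    qed
    then show ?thesis by simp
  qed
  ultimately have nash: "r ^ 3 * (LINT x|lborel. extend_zero \<Omega> (\<lambda>x. ?e x ^ 4) x) \<le> 2 * (LINT x|lborel. ?f x)\<^sup>2 +
     r ^ 5 * (LINT x|lborel. extend_zero \<Omega> (\<lambda>x. 12 * (?e x)\<^sup>2 * (grad (c t) x \<bullet> grad (c t) x)) x)"
    by simp
  have powers: "r ^ 5 = r ^ 3 * r\<^sup>2" by (simp add: power_add[symmetric])
  have divide: "E \<le> 2 * m / q + s * G" if "q * E \<le> 2 * m + p * G" "p = q * s" "q > 0" for E m G p q s :: real
    using that by (simp add: field_simps)
  show ?thesis by (rule divide[OF nash powers]) (use r in simp)
qed

section \<open>Renormalised transport\<close>

text \<open>The field under the divergence in the balance of \<open>F f\<close>: diffusion, drift in the potential \<open>\<phi>\<close>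
  with charge \<open>z\<close>, transport by \<open>w\<close>.\<close>
definition flux ::
  "real \<Rightarrow> real \<Rightarrow> (real \<Rightarrow> real) \<Rightarrow> (real \<Rightarrow> real) \<Rightarrow> (real^'n::finite \<Rightarrow> real) \<Rightarrow> (real^'n \<Rightarrow> real) \<Rightarrow>
   (real^'n \<Rightarrow> real^'n) \<Rightarrow> 'n \<Rightarrow> real^'n \<Rightarrow> real" where
  "flux D z F F' f \<phi> w i y =
     D * (F' (f y) * partial i f y + z * F (f y) * partial i \<phi> y) - w y $ i * F (f y)"

text \<open>The expression that the product and chain rules give for the derivative of \<open>flux \<dots> i\<close> in the
  direction \<open>i\<close>, where \<open>F'\<close> and \<open>F''\<close> stand for the derivatives of \<open>F\<close>. Writing it out makes its
  continuity and its support evident.\<close>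
definition flux_partial ::
  "real \<Rightarrow> real \<Rightarrow> (real \<Rightarrow> real) \<Rightarrow> (real \<Rightarrow> real) \<Rightarrow> (real \<Rightarrow> real) \<Rightarrow> (real^'n::finite \<Rightarrow> real) \<Rightarrow>
   (real^'n \<Rightarrow> real) \<Rightarrow> (real^'n \<Rightarrow> real^'n) \<Rightarrow> 'n \<Rightarrow> real^'n \<Rightarrow> real" where
  "flux_partial D z F F' F'' f \<phi> w i y =
     D * (F'' (f y) * (partial i f y)\<^sup>2 + F' (f y) * partial i (partial i f) y
          + z * (F' (f y) * partial i f y * partial i \<phi> y + F (f y) * partial i (partial i \<phi>) y))
     - (partial i (\<lambda>y. w y $ i) y * F (f y) + w y $ i * (F' (f y) * partial i f y))"

lemma DERIV_flux:
  assumes "f differentiable at x" "partial i f differentiable at x"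
    "partial i \<phi> differentiable at x" "(\<lambda>y. w y $ i) differentiable at x"
    and F: "\<And>s. (F has_real_derivative F' s) (at s)" "\<And>s. (F' has_real_derivative F'' s) (at s)"
  shows "((\<lambda>s. flux D z F F' f \<phi> w i (x + s *\<^sub>R axis i 1)) has_real_derivative
           flux_partial D z F F' F'' f \<phi> w i x) (at 0)"
proof -
  note d = DERIV_partial[OF assms(1), of i] DERIV_partial[OF assms(2), of i]
    DERIV_partial[OF assms(3), of i] DERIV_partial[OF assms(4), of i]
  have "((\<lambda>s. F (f (x + s *\<^sub>R axis i 1))) has_real_derivative F' (f x) * partial i f x) (at 0)"
    using DERIV_chain2[OF F(1) d(1)] by simp
  moreover have "((\<lambda>s. F' (f (x + s *\<^sub>R axis i 1))) has_real_derivative F'' (f x) * partial i f x) (at 0)"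
    using DERIV_chain2[OF F(2) d(1)] by simp
  ultimately show ?thesis
    unfolding flux_def flux_partial_def
    using d by (auto intro!: derivative_eq_intros simp: algebra_simps power2_eq_square)
qed

lemma divergence_flux:
  assumes "f differentiable at x" "\<And>i. partial i f differentiable at x"
    "\<And>i. partial i \<phi> differentiable at x"
  shows "divergence (\<lambda>y. grad f y + (z * f y) *\<^sub>R grad \<phi> y) x =
           laplacian f x + z * (grad f x \<bullet> grad \<phi> x + f x * laplacian \<phi> x)"
proof -
  have "partial i (\<lambda>y. (grad f y + (z * f y) *\<^sub>R grad \<phi> y) $ i) x =
        partial i (partial i f) x + z * (partial i f x * partial i \<phi> x + f x * partial i (partial i \<phi>) x)" for i
  proof (rule partial_eqI)
    show "(\<lambda>y. (grad f y + (z * f y) *\<^sub>R grad \<phi> y) $ i) differentiable at x"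
      using assms by (auto simp: grad_def intro!: differentiable_add differentiable_mult)
    show "((\<lambda>s. (grad f (x + s *\<^sub>R axis i 1) + (z * f (x + s *\<^sub>R axis i 1)) *\<^sub>R grad \<phi> (x + s *\<^sub>R axis i 1)) $ i)
        has_real_derivative
        partial i (partial i f) x + z * (partial i f x * partial i \<phi> x + f x * partial i (partial i \<phi>) x)) (at 0)"
      using DERIV_partial[OF assms(1), of i] DERIV_partial[OF assms(2), of i i]
        DERIV_partial[OF assms(3), of i i]
      by (auto simp: grad_def intro!: derivative_eq_intros simp: algebra_simps)
  qed
  then show ?thesis
    by (simp add: divergence_def laplacian_def inner_vec_def grad_def sum.distrib sum_distrib_left algebra_simps)
qed

text \<open>Multiplying the equation by \<open>F' f\<close> leaves, besides a divergence, the dissipation and a multiple of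
  the Laplacian of the potential. The gradient of the potential and the velocity itself occur under
  the divergence only.\<close>
lemma renormalized_transport:
  assumes "f differentiable at x" "\<And>i. partial i f differentiable at x"
    "\<And>i. partial i \<phi> differentiable at x" "divergence w x = 0"
    and eq: "d + w x \<bullet> grad f x = D * divergence (\<lambda>y. grad f y + (z * f y) *\<^sub>R grad \<phi> y) x"
  shows "F' (f x) * d = (\<Sum>i\<in>UNIV. flux_partial D z F F' F'' f \<phi> w i x)
           - D * (F'' (f x) * (grad f x \<bullet> grad f x)) + D * z * (f x * F' (f x) - F (f x)) * laplacian \<phi> x"
proof -
  let ?F = "F (f x)" and ?F' = "F' (f x)" and ?F'' = "F'' (f x)"
  have total: "(\<Sum>i\<in>UNIV. flux_partial D z F F' F'' f \<phi> w i x) =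
    D * (?F'' * (grad f x \<bullet> grad f x) + ?F' * laplacian f x
          + z * (?F' * (grad f x \<bullet> grad \<phi> x) + ?F * laplacian \<phi> x))
     - (divergence w x * ?F + ?F' * (w x \<bullet> grad f x))"
    unfolding flux_partial_def
    by (simp add: sum_subtractf sum.distrib sum_distrib_left sum_distrib_right divergence_def laplacian_def
        inner_vec_def grad_def power2_eq_square algebra_simps)
  have rate: "d = D * (laplacian f x + z * (grad f x \<bullet> grad \<phi> x + f x * laplacian \<phi> x)) - w x \<bullet> grad f x"
    using eq divergence_flux[OF assms(1-3), of z] by simp
  show ?thesis unfolding total rate assms(4) by (simp add: algebra_simps)
qed

lemma continuous_on_flux:
  assumes c: "evolves_smoothly_on \<Omega> c" and \<Phi>: "evolves_smoothly_on \<Omega> \<Phi>"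
    and u: "evolves_smoothly_on \<Omega> u" and \<Omega>: "open \<Omega>" and t: "t > 0"
    and F: "continuous_on UNIV F" "continuous_on UNIV F'" "continuous_on UNIV F''"
  shows "continuous_on \<Omega> (flux D z F F' (c t) (\<Phi> t) (u t) i)"
    "continuous_on \<Omega> (flux_partial D z F F' F'' (c t) (\<Phi> t) (u t) i)"
proof -
  note u' = evolves_smoothly_on_component[OF u \<Omega>, of i]
  have comp: "continuous_on \<Omega> (\<lambda>x. h (c t x))" if "continuous_on UNIV h" for h :: "real \<Rightarrow> real"
    by (rule continuous_on_compose2[OF that evolves_smoothly_on_continuous_space[OF c t]]) simp
  show "continuous_on \<Omega> (flux D z F F' (c t) (\<Phi> t) (u t) i)"
    unfolding flux_def
    by (intro continuous_on_diff continuous_on_mult continuous_on_add continuous_on_const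
        comp F evolves_smoothly_on_partial_regularity(1)[OF c \<Omega> t]
        evolves_smoothly_on_partial_regularity(1)[OF \<Phi> \<Omega> t]
        evolves_smoothly_on_continuous_space[OF u' t])
  show "continuous_on \<Omega> (flux_partial D z F F' F'' (c t) (\<Phi> t) (u t) i)"
    unfolding flux_partial_def power2_eq_square
    by (intro continuous_on_diff continuous_on_mult continuous_on_add continuous_on_const
        comp F evolves_smoothly_on_partial_regularity(1,2)[OF c \<Omega> t]
        evolves_smoothly_on_partial_regularity(1,2)[OF \<Phi> \<Omega> t]
        evolves_smoothly_on_continuous_space[OF u' t]
        evolves_smoothly_on_partial_regularity(1)[OF u' \<Omega> t])
qed

section \<open>Extrema of a pair of functions on a set\<close>

lemma max_sup_upper:
  assumes "bdd_above (f ` S)" "bdd_above (g ` S)" "x \<in> S"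
  shows "f x \<le> max_sup S f g" "g x \<le> max_sup S f g"
  using cSUP_upper[OF assms(3,1)] cSUP_upper[OF assms(3,2)] by (simp_all add: max_sup_def le_max_iff_disj)

lemma max_sup_least:
  assumes "S \<noteq> {}" "\<And>x. x \<in> S \<Longrightarrow> f x \<le> b \<and> g x \<le> b"
  shows "max_sup S f g \<le> b"
  using assms by (auto simp: max_sup_def intro!: cSUP_least)

lemma min_inf_lower:
  assumes "bdd_below (f ` S)" "bdd_below (g ` S)" "x \<in> S"
  shows "min_inf S f g \<le> f x" "min_inf S f g \<le> g x"
  using cINF_lower[OF assms(1,3)] cINF_lower[OF assms(2,3)] by (simp_all add: min_inf_def min_le_iff_disj)

lemma min_inf_greatest:
  assumes "S \<noteq> {}" "\<And>x. x \<in> S \<Longrightarrow> b \<le> f x \<and> b \<le> g x"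
  shows "b \<le> min_inf S f g"
  using assms by (auto simp: min_inf_def intro!: cINF_greatest)

lemma smooth_on_compact_bdd:
  fixes f :: "'a::real_normed_vector \<Rightarrow> real"
  assumes "compact S" "smooth_on S f"
  shows "bdd_above (f ` S)" "bdd_below (f ` S)"
proof -
  have "compact (f ` S)"
    using assms by (intro compact_continuous_image smooth_on_imp_continuous_on)
  then have "bounded (f ` S)" by (rule compact_imp_bounded)
  then show "bdd_above (f ` S)" "bdd_below (f ` S)"
    by (rule bounded_imp_bdd_above bounded_imp_bdd_below)+
qed

lemma compact_frontier_domain: "smooth_bounded_domain \<Omega> \<Longrightarrow> compact (frontier \<Omega>)"
  unfolding smooth_bounded_domain_def by (auto intro: compact_frontier_bounded)

section \<open>The energy of a solution\<close>

locale npns_flow =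
  fixes \<Omega> :: "(real^3) set" and D1 D2 \<epsilon> \<nu> \<kappa> :: real
    and \<gamma>1 \<gamma>2 W c10 c20 :: "real^3 \<Rightarrow> real" and u0 :: "real^3 \<Rightarrow> real^3"
    and c1 c2 :: "real \<Rightarrow> real^3 \<Rightarrow> real" and u :: "real \<Rightarrow> real^3 \<Rightarrow> real^3"
    and \<Phi> p :: "real \<Rightarrow> real^3 \<Rightarrow> real"
  assumes domain: "smooth_bounded_domain \<Omega>"
    and D1: "D1 > 0" and D2: "D2 > 0" and \<epsilon>: "\<epsilon> > 0"
    and solution: "npns_solution \<Omega> D1 D2 \<epsilon> \<nu> \<kappa> \<gamma>1 \<gamma>2 W c10 c20 u0 c1 c2 u \<Phi> p"
begin

lemma open_domain: "open \<Omega>" and bounded_domain: "bounded \<Omega>" and domain_nonempty: "\<Omega> \<noteq> {}"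
  using domain by (auto simp: smooth_bounded_domain_def)

lemma smooth_evolutions:
  "smooth_evolution \<Omega> c10 c1" "smooth_evolution \<Omega> c20 c2" "smooth_evolution \<Omega> u0 u"
  "smooth_on ({0<..} \<times> closure \<Omega>) (\<lambda>(t, x). \<Phi> t x)"
  using solution unfolding npns_solution_def by auto

lemma evolves:
  "evolves_smoothly_on \<Omega> c1" "evolves_smoothly_on \<Omega> c2" "evolves_smoothly_on \<Omega> u" "evolves_smoothly_on \<Omega> \<Phi>"
  using smooth_evolutions unfolding smooth_evolution_def
  by (auto intro: smooth_on_imp_evolves_smoothly_on[OF open_domain])

lemma continuous_closure:
  "continuous_on ({0<..} \<times> closure \<Omega>) (\<lambda>(t, x). c1 t x)"
  "continuous_on ({0<..} \<times> closure \<Omega>) (\<lambda>(t, x). c2 t x)"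
  using smooth_evolutions unfolding smooth_evolution_def by (auto intro: smooth_on_imp_continuous_on)

lemma concentrations_nonneg: "t \<ge> 0 \<Longrightarrow> x \<in> \<Omega> \<Longrightarrow> c1 t x \<ge> 0 \<and> c2 t x \<ge> 0"
  using solution unfolding npns_solution_def by auto

lemma boundary_values: "t > 0 \<Longrightarrow> x \<in> frontier \<Omega> \<Longrightarrow> c1 t x = \<gamma>1 x \<and> c2 t x = \<gamma>2 x"
  using solution unfolding npns_solution_def by auto

lemma equations:
  assumes "t > 0" "x \<in> \<Omega>"
  shows "dt c1 t x + u t x \<bullet> grad (c1 t) x =
          D1 * divergence (\<lambda>y. grad (c1 t) y + (1 * c1 t y) *\<^sub>R grad (\<Phi> t) y) x"
    and "dt c2 t x + u t x \<bullet> grad (c2 t) x =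
          D2 * divergence (\<lambda>y. grad (c2 t) y + (- 1 * c2 t y) *\<^sub>R grad (\<Phi> t) y) x"
    and "- \<epsilon> * laplacian (\<Phi> t) x = c1 t x - c2 t x"
    and "divergence (u t) x = 0"
  using solution assms unfolding npns_solution_def by auto

text \<open>The weights \<open>1 / D1\<close> and \<open>1 / D2\<close> give the electric terms of the two species the same
  coefficient, so that they combine to one term with a sign.\<close>
definition energy :: "real \<Rightarrow> real \<Rightarrow> real \<Rightarrow> real" where
  "energy \<sigma> k t = (LINT x|lborel. extend_zero \<Omega> (\<lambda>x. excess \<sigma> k (c1 t x) ^ 4 / D1 + excess \<sigma> k (c2 t x) ^ 4 / D2) x)"

definition dissipation :: "real \<Rightarrow> real \<Rightarrow> real \<Rightarrow> real" where
  "dissipation \<sigma> k t = (LINT x|lborel. extend_zero \<Omega> (\<lambda>x.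
     12 * (excess \<sigma> k (c1 t x))\<^sup>2 * (grad (c1 t) x \<bullet> grad (c1 t) x) +
     12 * (excess \<sigma> k (c2 t x))\<^sup>2 * (grad (c2 t) x \<bullet> grad (c2 t) x)) x)"

definition mass :: "real \<Rightarrow> real \<Rightarrow> real \<Rightarrow> real" where
  "mass \<sigma> k t = (LINT x|lborel. extend_zero \<Omega> (\<lambda>x. (excess \<sigma> k (c1 t x))\<^sup>2 + (excess \<sigma> k (c2 t x))\<^sup>2) x)"

text \<open>The inequalities are strict, so that the excess vanishes near the boundary.\<close>
definition barrier :: "real \<Rightarrow> real \<Rightarrow> bool" where
  "barrier \<sigma> k \<longleftrightarrow> \<sigma>\<^sup>2 = 1 \<and> (\<forall>x\<in>frontier \<Omega>. \<sigma> * \<gamma>1 x < \<sigma> * k \<and> \<sigma> * \<gamma>2 x < \<sigma> * k)"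

lemma barrier_support:
  assumes "barrier \<sigma> k" "a > 0"
  obtains K where "compact K" "K \<subseteq> \<Omega>"
    "\<And>t x. t \<in> {a..b} \<Longrightarrow> x \<in> \<Omega> - K \<Longrightarrow> excess \<sigma> k (c1 t x) = 0"
    "\<And>t x. t \<in> {a..b} \<Longrightarrow> x \<in> \<Omega> - K \<Longrightarrow> excess \<sigma> k (c2 t x) = 0"
proof -
  have b1: "\<sigma> * c1 t x < \<sigma> * k" and b2: "\<sigma> * c2 t x < \<sigma> * k" if "t > 0" "x \<in> frontier \<Omega>" for t x
    using assms(1) boundary_values[OF that] that(2) unfolding barrier_def by auto
  obtain K1 where K1: "compact K1" "K1 \<subseteq> \<Omega>"
    "\<And>t x. t \<in> {a..b} \<Longrightarrow> x \<in> \<Omega> - K1 \<Longrightarrow> excess \<sigma> k (c1 t x) = 0"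
    using compact_excess_support[OF open_domain bounded_domain continuous_closure(1) b1 assms(2)] by metis
  obtain K2 where K2: "compact K2" "K2 \<subseteq> \<Omega>"
    "\<And>t x. t \<in> {a..b} \<Longrightarrow> x \<in> \<Omega> - K2 \<Longrightarrow> excess \<sigma> k (c2 t x) = 0"
    using compact_excess_support[OF open_domain bounded_domain continuous_closure(2) b2 assms(2)] by metis
  show ?thesis
    by (rule that[of "K1 \<union> K2"]) (use K1 K2 in \<open>auto intro: compact_Un\<close>)
qed

lemma continuous_excess:
  assumes "t > 0"
  shows "continuous_on \<Omega> (\<lambda>x. excess \<sigma> k (c1 t x))" "continuous_on \<Omega> (\<lambda>x. excess \<sigma> k (c2 t x))"
  by (rule continuous_on_excess, rule evolves_smoothly_on_continuous_space[OF _ assms], rule evolves)+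

lemma continuous_grad_square:
  assumes "t > 0"
  shows "continuous_on \<Omega> (\<lambda>x. grad (c1 t) x \<bullet> grad (c1 t) x)" "continuous_on \<Omega> (\<lambda>x. grad (c2 t) x \<bullet> grad (c2 t) x)"
  unfolding grad_def
  by (intro continuous_intros evolves_smoothly_on_partial_regularity(1)[OF evolves(1) open_domain assms]
      evolves_smoothly_on_partial_regularity(1)[OF evolves(2) open_domain assms])+

lemma integrable_species:
  assumes "barrier \<sigma> k" "t > 0"
  shows "integrable lborel (extend_zero \<Omega> (\<lambda>x. (excess \<sigma> k (c1 t x)) ^ Suc n))"
    "integrable lborel (extend_zero \<Omega> (\<lambda>x. (excess \<sigma> k (c2 t x)) ^ Suc n))"
    "integrable lborel (extend_zero \<Omega> (\<lambda>x. 12 * (excess \<sigma> k (c1 t x))\<^sup>2 * (grad (c1 t) x \<bullet> grad (c1 t) x)))"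
    "integrable lborel (extend_zero \<Omega> (\<lambda>x. 12 * (excess \<sigma> k (c2 t x))\<^sup>2 * (grad (c2 t) x \<bullet> grad (c2 t) x)))"
proof -
  obtain K where K: "compact K" "K \<subseteq> \<Omega>" "\<And>s x. s \<in> {t..t} \<Longrightarrow> x \<in> \<Omega> - K \<Longrightarrow> excess \<sigma> k (c1 s x) = 0"
    "\<And>s x. s \<in> {t..t} \<Longrightarrow> x \<in> \<Omega> - K \<Longrightarrow> excess \<sigma> k (c2 s x) = 0"
    using barrier_support[OF assms, of t] by metis
  have I: "integrable lborel (extend_zero \<Omega> f)"
    if "continuous_on \<Omega> f" "\<And>x. x \<in> \<Omega> - K \<Longrightarrow> f x = 0" for f
    using that by (rule integrable_extend_zero[OF open_domain K(1,2)])
  note c = continuous_excess[OF assms(2)] continuous_grad_square[OF assms(2)]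
  show "integrable lborel (extend_zero \<Omega> (\<lambda>x. (excess \<sigma> k (c1 t x)) ^ Suc n))"
    "integrable lborel (extend_zero \<Omega> (\<lambda>x. (excess \<sigma> k (c2 t x)) ^ Suc n))"
    "integrable lborel (extend_zero \<Omega> (\<lambda>x. 12 * (excess \<sigma> k (c1 t x))\<^sup>2 * (grad (c1 t) x \<bullet> grad (c1 t) x)))"
    "integrable lborel (extend_zero \<Omega> (\<lambda>x. 12 * (excess \<sigma> k (c2 t x))\<^sup>2 * (grad (c2 t) x \<bullet> grad (c2 t) x)))"
    by (rule I; (intro continuous_on_mult continuous_on_power continuous_on_const c)?; use K in simp)+
qed

lemma integrable_energy:
  assumes "barrier \<sigma> k" "t > 0"
  shows "integrable lborel (extend_zero \<Omega> (\<lambda>x. excess \<sigma> k (c1 t x) ^ 4 / D1 + excess \<sigma> k (c2 t x) ^ 4 / D2))"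
proof -
  have "extend_zero \<Omega> (\<lambda>x. excess \<sigma> k (c1 t x) ^ 4 / D1 + excess \<sigma> k (c2 t x) ^ 4 / D2) =
    (\<lambda>x. extend_zero \<Omega> (\<lambda>x. (excess \<sigma> k (c1 t x)) ^ Suc 3) x / D1 +
      extend_zero \<Omega> (\<lambda>x. (excess \<sigma> k (c2 t x)) ^ Suc 3) x / D2)"
    by (auto simp: extend_zero_def)
  then show ?thesis
    using integrable_species(1,2)[OF assms, of 3] by (simp only: Bochner_Integration.integrable_add integrable_divide)
qed

lemma energy_split:
  assumes "barrier \<sigma> k" "t > 0"
  shows "energy \<sigma> k t = (LINT x|lborel. extend_zero \<Omega> (\<lambda>x. excess \<sigma> k (c1 t x) ^ 4) x) / D1 +
      (LINT x|lborel. extend_zero \<Omega> (\<lambda>x. excess \<sigma> k (c2 t x) ^ 4) x) / D2"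
proof -
  have "extend_zero \<Omega> (\<lambda>x. excess \<sigma> k (c1 t x) ^ 4 / D1 + excess \<sigma> k (c2 t x) ^ 4 / D2) =
    (\<lambda>x. extend_zero \<Omega> (\<lambda>x. excess \<sigma> k (c1 t x) ^ 4) x / D1 + extend_zero \<Omega> (\<lambda>x. excess \<sigma> k (c2 t x) ^ 4) x / D2)"
    by (auto simp: extend_zero_def)
  then show ?thesis
    using integrable_species(1,2)[OF assms, of 3] by (simp add: energy_def)
qed

lemma energy_nonneg: "energy \<sigma> k t \<ge> 0"
  unfolding energy_def using D1 D2 by (intro Bochner_Integration.integral_nonneg) (auto simp: extend_zero_def)

lemma dissipation_nonneg: "dissipation \<sigma> k t \<ge> 0"
  unfolding dissipation_def by (intro Bochner_Integration.integral_nonneg) (auto simp: extend_zero_def)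

lemma mass_nonneg: "mass \<sigma> k t \<ge> 0"
  unfolding mass_def by (intro Bochner_Integration.integral_nonneg) (auto simp: extend_zero_def)

text \<open>The length scale \<open>r\<close> stays free: the iteration needs a different one at every level.\<close>
lemma energy_nash:
  assumes b: "barrier \<sigma> k" and t: "t > 0" and r: "r > 0"
  shows "energy \<sigma> k t \<le> (1 / D1 + 1 / D2) * (r\<^sup>2 * dissipation \<sigma> k t + 2 * (mass \<sigma> k t)\<^sup>2 / r ^ 3)"
proof -
  obtain K where K: "compact K" "K \<subseteq> \<Omega>" "\<And>s x. s \<in> {t..t} \<Longrightarrow> x \<in> \<Omega> - K \<Longrightarrow> excess \<sigma> k (c1 s x) = 0"
    "\<And>s x. s \<in> {t..t} \<Longrightarrow> x \<in> \<Omega> - K \<Longrightarrow> excess \<sigma> k (c2 s x) = 0"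
    using barrier_support[OF b t, of t] by metis
  have \<sigma>: "\<sigma>\<^sup>2 = 1" using b by (simp add: barrier_def)
  define E1 E2 where "E1 = (LINT x|lborel. extend_zero \<Omega> (\<lambda>x. excess \<sigma> k (c1 t x) ^ 4) x)"
    and "E2 = (LINT x|lborel. extend_zero \<Omega> (\<lambda>x. excess \<sigma> k (c2 t x) ^ 4) x)"
  define m1 m2 where "m1 = (LINT x|lborel. extend_zero \<Omega> (\<lambda>x. (excess \<sigma> k (c1 t x))\<^sup>2) x)"
    and "m2 = (LINT x|lborel. extend_zero \<Omega> (\<lambda>x. (excess \<sigma> k (c2 t x))\<^sup>2) x)"
  define G1 G2 where "G1 = (LINT x|lborel. extend_zero \<Omega> (\<lambda>x. 12 * (excess \<sigma> k (c1 t x))\<^sup>2 * (grad (c1 t) x \<bullet> grad (c1 t) x)) x)"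
    and "G2 = (LINT x|lborel. extend_zero \<Omega> (\<lambda>x. 12 * (excess \<sigma> k (c2 t x))\<^sup>2 * (grad (c2 t) x \<bullet> grad (c2 t) x)) x)"
  have E: "E1 \<le> 2 * m1\<^sup>2 / r ^ 3 + r\<^sup>2 * G1" "E2 \<le> 2 * m2\<^sup>2 / r ^ 3 + r\<^sup>2 * G2"
    unfolding E1_def E2_def m1_def m2_def G1_def G2_def
    by (rule excess_nash[OF open_domain K(1,2) _ t _ \<sigma> r]; use evolves K(3,4) in simp)+
  have nonneg: "E1 \<ge> 0" "E2 \<ge> 0" "m1 \<ge> 0" "m2 \<ge> 0"
    unfolding E1_def E2_def m1_def m2_def
    by (intro Bochner_Integration.integral_nonneg; simp add: extend_zero_def)+
  have mass: "mass \<sigma> k t = m1 + m2"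
  proof -
    have "extend_zero \<Omega> (\<lambda>x. (excess \<sigma> k (c1 t x))\<^sup>2 + (excess \<sigma> k (c2 t x))\<^sup>2) =
      (\<lambda>x. extend_zero \<Omega> (\<lambda>x. (excess \<sigma> k (c1 t x))\<^sup>2) x + extend_zero \<Omega> (\<lambda>x. (excess \<sigma> k (c2 t x))\<^sup>2) x)"
      by (auto simp: extend_zero_def)
    then show ?thesis unfolding mass_def m1_def m2_def
      using integrable_species(1,2)[OF b t, of 1] by (simp add: numeral_2_eq_2)
  qed
  have diss: "dissipation \<sigma> k t = G1 + G2"
  proof -
    have "extend_zero \<Omega> (\<lambda>x. 12 * (excess \<sigma> k (c1 t x))\<^sup>2 * (grad (c1 t) x \<bullet> grad (c1 t) x) +
        12 * (excess \<sigma> k (c2 t x))\<^sup>2 * (grad (c2 t) x \<bullet> grad (c2 t) x)) =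
      (\<lambda>x. extend_zero \<Omega> (\<lambda>x. 12 * (excess \<sigma> k (c1 t x))\<^sup>2 * (grad (c1 t) x \<bullet> grad (c1 t) x)) x +
        extend_zero \<Omega> (\<lambda>x. 12 * (excess \<sigma> k (c2 t x))\<^sup>2 * (grad (c2 t) x \<bullet> grad (c2 t) x)) x)"
      by (auto simp: extend_zero_def)
    then show ?thesis unfolding dissipation_def G1_def G2_def
      using integrable_species(3,4)[OF b t] by simp
  qed
  have "energy \<sigma> k t = E1 / D1 + E2 / D2"
    unfolding E1_def E2_def by (rule energy_split[OF b t])
  also have "\<dots> \<le> (1 / D1 + 1 / D2) * (E1 + E2)"
    using nonneg D1 D2 by (simp add: field_simps)
  also have "\<dots> \<le> (1 / D1 + 1 / D2) * (r\<^sup>2 * (G1 + G2) + 2 * (m1 + m2)\<^sup>2 / r ^ 3)"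
  proof (intro mult_left_mono)
    have "2 * m1\<^sup>2 / r ^ 3 + 2 * m2\<^sup>2 / r ^ 3 \<le> 2 * (m1 + m2)\<^sup>2 / r ^ 3"
      unfolding add_divide_distrib[symmetric] using nonneg r
      by (intro divide_right_mono) (auto simp: power2_sum)
    then show "E1 + E2 \<le> r\<^sup>2 * (G1 + G2) + 2 * (m1 + m2)\<^sup>2 / r ^ 3"
      using E by (simp add: distrib_left)
  qed (use D1 D2 in simp)
  finally show ?thesis by (simp add: mass diss)
qed

lemma barrier_shift:
  assumes "barrier \<sigma> k" "d \<ge> 0"
  shows "barrier \<sigma> (k + \<sigma> * d)"
proof -
  have "\<sigma> * (k + \<sigma> * d) = \<sigma> * k + d"
    using assms(1) by (simp add: barrier_def algebra_simps power2_eq_square)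
  then show ?thesis using assms by (force simp: barrier_def)
qed

lemma energy_antimono_level:
  assumes b: "barrier \<sigma> k" and d: "d > 0" and t: "t > 0"
  shows "energy \<sigma> (k + \<sigma> * d) t \<le> energy \<sigma> k t"
proof -
  have \<sigma>: "\<sigma>\<^sup>2 = 1" using b by (simp add: barrier_def)
  have b': "barrier \<sigma> (k + \<sigma> * d)" using barrier_shift[OF b] d by simp
  show ?thesis unfolding energy_split[OF b t] energy_split[OF b' t]
    using integrable_species(1,2)[OF b t, of 3] integrable_species(1,2)[OF b' t, of 3] excess_chebyshev(2)[OF \<sigma> d] D1 D2
    by (intro add_mono divide_right_mono integral_mono) (auto simp: extend_zero_def intro!: power_mono)
qed

lemma mass_chebyshev:
  assumes b: "barrier \<sigma> k" and d: "d > 0" and t: "t > 0"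
  shows "mass \<sigma> (k + \<sigma> * d) t \<le> (D1 + D2) / d\<^sup>2 * energy \<sigma> k t"
proof -
  have \<sigma>: "\<sigma>\<^sup>2 = 1" using b by (simp add: barrier_def)
  have b': "barrier \<sigma> (k + \<sigma> * d)" using barrier_shift[OF b] d by simp
  let ?m = "extend_zero \<Omega> (\<lambda>x. (excess \<sigma> (k + \<sigma> * d) (c1 t x))\<^sup>2 + (excess \<sigma> (k + \<sigma> * d) (c2 t x))\<^sup>2)"
  let ?e = "extend_zero \<Omega> (\<lambda>x. excess \<sigma> k (c1 t x) ^ 4 / D1 + excess \<sigma> k (c2 t x) ^ 4 / D2)"
  have "?m = (\<lambda>x. extend_zero \<Omega> (\<lambda>x. (excess \<sigma> (k + \<sigma> * d) (c1 t x)) ^ Suc 1) x +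
      extend_zero \<Omega> (\<lambda>x. (excess \<sigma> (k + \<sigma> * d) (c2 t x)) ^ Suc 1) x)"
    by (auto simp: extend_zero_def power2_eq_square)
  then have i1: "integrable lborel ?m"
    using integrable_species(1,2)[OF b' t, of 1] by (simp only: Bochner_Integration.integrable_add)
  have i2: "integrable lborel ?e" by (rule integrable_energy[OF b t])
  have "?m x \<le> (D1 + D2) / d\<^sup>2 * ?e x" for x
  proof (cases "x \<in> \<Omega>")
    case True
    have "excess \<sigma> k (c1 t x) ^ 4 \<le> (D1 + D2) * (excess \<sigma> k (c1 t x) ^ 4 / D1)"
      "excess \<sigma> k (c2 t x) ^ 4 \<le> (D1 + D2) * (excess \<sigma> k (c2 t x) ^ 4 / D2)"
      using D1 D2 by (auto simp: field_simps)
    then have "excess \<sigma> k (c1 t x) ^ 4 / d\<^sup>2 + excess \<sigma> k (c2 t x) ^ 4 / d\<^sup>2 \<le>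
        (D1 + D2) * (excess \<sigma> k (c1 t x) ^ 4 / D1 + excess \<sigma> k (c2 t x) ^ 4 / D2) / d\<^sup>2"
      unfolding add_divide_distrib[symmetric] by (intro divide_right_mono) (simp_all add: distrib_left)
    then show ?thesis
      using True excess_chebyshev(1)[OF \<sigma> d, of k "c1 t x"] excess_chebyshev(1)[OF \<sigma> d, of k "c2 t x"]
      by (simp add: extend_zero_def)
  qed (simp add: extend_zero_def)
  then have "integral\<^sup>L lborel ?m \<le> (LINT x|lborel. (D1 + D2) / d\<^sup>2 * ?e x)"
    using i1 i2 by (intro integral_mono) auto
  then show ?thesis by (simp add: mass_def energy_def)
qed

text \<open>The electric field acts through \<open>(H c\<^sub>1 - H c\<^sub>2) * \<Delta>\<Phi>\<close>, and \<open>\<Delta>\<Phi>\<close> has the sign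
  opposite to \<open>c\<^sub>1 - c\<^sub>2\<close>. A nondecreasing \<open>H\<close> therefore makes this contribution nonpositive.\<close>
lemma energy_decay:
  assumes b: "barrier \<sigma> k" and t: "t > 0"
  shows "\<exists>y'. (energy \<sigma> k has_real_derivative y') (at t) \<and> y' \<le> - dissipation \<sigma> k t"
proof -
  define F F' F'' where "F = (\<lambda>s. excess \<sigma> k s ^ 4)" and "F' = (\<lambda>s. 4 * \<sigma> * excess \<sigma> k s ^ 3)"
    and "F'' = (\<lambda>s. 12 * \<sigma>\<^sup>2 * (excess \<sigma> k s)\<^sup>2)"
  have \<sigma>: "\<sigma>\<^sup>2 = 1" using b by (simp add: barrier_def)
  have DF: "(F has_real_derivative F' s) (at s)" "(F' has_real_derivative F'' s) (at s)" for s
    unfolding F_def F'_def F''_def by (rule DERIV_excess_4 DERIV_excess_3)+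
  have CF: "continuous_on UNIV F" "continuous_on UNIV F'" "continuous_on UNIV F''"
    unfolding F_def F'_def F''_def by (intro continuous_intros)+
  \<comment> \<open>Differentiating under the integral needs one support for all times near \<open>t\<close>.\<close>
  obtain K where K: "compact K" "K \<subseteq> \<Omega>"
    "\<And>s x. s \<in> {t/2..2*t} \<Longrightarrow> x \<in> \<Omega> - K \<Longrightarrow> excess \<sigma> k (c1 s x) = 0"
    "\<And>s x. s \<in> {t/2..2*t} \<Longrightarrow> x \<in> \<Omega> - K \<Longrightarrow> excess \<sigma> k (c2 s x) = 0"
    using barrier_support[OF b, of "t/2" "2*t"] t by auto
  have K': "closed K" using K(1) by (rule compact_imp_closed)
  have FK: "F (c1 s x) = 0" "F' (c1 s x) = 0" "F'' (c1 s x) = 0" "F (c2 s x) = 0" "F' (c2 s x) = 0" "F'' (c2 s x) = 0"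
    if "s \<in> {t/2..2*t}" "x \<in> \<Omega> - K" for s x
    using K(3,4)[OF that] by (simp_all add: F_def F'_def F''_def)
  define f where "f s x = F (c1 s x) / D1 + F (c2 s x) / D2" for s x
  define rate where "rate s x = F' (c1 s x) * dt c1 s x / D1 + F' (c2 s x) * dt c2 s x / D2" for s x
  let ?U = "{t/2<..<2*t}"
  have U: "s > 0" "s \<in> {t/2..2*t}" if "s \<in> ?U" for s using that t by auto
  have tt: "t \<in> {t/2..2*t}" using t by simp
  have f0: "f s x = 0" "rate s x = 0" if "s \<in> {t/2..2*t}" "x \<in> \<Omega> - K" for s x
    using FK[OF that] by (simp_all add: f_def rate_def)
  have compF: "continuous_on S (\<lambda>z. h (g z))" if "continuous_on UNIV h" "continuous_on S g"
    for h :: "real \<Rightarrow> real" and S and g :: "'z::topological_space \<Rightarrow> real"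
    by (rule continuous_on_compose2[OF that]) simp
  have joint: "continuous_on (?U \<times> \<Omega>) (\<lambda>z. g (fst z) (snd z))" if "evolves_smoothly_on \<Omega> g" for g :: "real \<Rightarrow> real^3 \<Rightarrow> real"
  proof -
    have "continuous_on (?U \<times> \<Omega>) (\<lambda>(s, x). g s x)"
      by (rule continuous_on_subset[OF evolves_smoothly_on_continuous[OF that]]) (use t in auto)
    then show ?thesis by (simp only: split_def)
  qed
  have f_cont: "continuous_on \<Omega> (f s)" if "s > 0" for s
    unfolding f_def
    by (intro continuous_on_add continuous_on_divide continuous_on_const compF[OF CF(1)]
        evolves_smoothly_on_continuous_space[OF _ that] evolves) (use D1 D2 in auto)
  have "((\<lambda>s. LINT x|lborel. extend_zero \<Omega> (f s) x) has_real_derivative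
      (LINT x|lborel. extend_zero \<Omega> (rate t) x)) (at t)"
  proof (rule leibniz_bounded_support[of ?U t K])
    show "bounded K" using K(1) by (rule compact_imp_bounded)
    show "extend_zero \<Omega> (f s) x = 0" if "s \<in> ?U" "x \<notin> K" for s x
      using f0(1)[OF U(2)[OF that(1)]] that(2) by (auto simp: extend_zero_def)
    show "continuous_on UNIV (extend_zero \<Omega> (f s))" if "s \<in> ?U" for s
      by (rule continuous_on_extend_zero[OF open_domain K' K(2) f_cont[OF U(1)[OF that]] f0(1)[OF U(2)[OF that]]])
    show "continuous_on (?U \<times> UNIV) (\<lambda>(s, x). extend_zero \<Omega> (rate s) x)"
    proof (rule continuous_on_extend_zero_family[OF _ open_domain K' K(2)])
      show "continuous_on (?U \<times> \<Omega>) (\<lambda>(s, x). rate s x)"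
        unfolding rate_def split_def
        by (intro continuous_on_add continuous_on_divide continuous_on_mult continuous_on_const compF[OF CF(2)]
            joint evolves evolves_smoothly_on_dt open_domain) (use D1 D2 in auto)
    qed (use f0(2) U(2) in auto)
    show "((\<lambda>s. extend_zero \<Omega> (f s) x) has_real_derivative extend_zero \<Omega> (rate s) x) (at s)" if "s \<in> ?U" for s x
    proof (cases "x \<in> \<Omega>")
      case True
      have "((\<lambda>s. F (c1 s x)) has_real_derivative F' (c1 s x) * dt c1 s x) (at s)"
        "((\<lambda>s. F (c2 s x)) has_real_derivative F' (c2 s x) * dt c2 s x) (at s)"
        by (rule DERIV_chain2[OF DF(1)], rule evolves_smoothly_on_DERIV_time[OF _ open_domain U(1)[OF that] True], rule evolves)+
      then have "((\<lambda>s. F (c1 s x) / D1 + F (c2 s x) / D2) has_real_derivative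
          F' (c1 s x) * dt c1 s x / D1 + F' (c2 s x) * dt c2 s x / D2) (at s)"
        by (intro DERIV_add DERIV_cdivide)
      then show ?thesis using True by (simp add: extend_zero_def f_def rate_def)
    qed (simp add: extend_zero_def)
  qed (use t in auto)
  moreover have "energy \<sigma> k = (\<lambda>s. LINT x|lborel. extend_zero \<Omega> (f s) x)"
    by (intro ext) (simp add: energy_def f_def[abs_def] F_def)
  ultimately have deriv: "(energy \<sigma> k has_real_derivative (LINT x|lborel. extend_zero \<Omega> (rate t) x)) (at t)"
    by simp
  define V where "V i x = flux D1 1 F F' (c1 t) (\<Phi> t) (u t) i x / D1 + flux D2 (- 1) F F' (c2 t) (\<Phi> t) (u t) i x / D2" for i x
  define V' where "V' i x = flux_partial D1 1 F F' F'' (c1 t) (\<Phi> t) (u t) i x / D1 +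
      flux_partial D2 (- 1) F F' F'' (c2 t) (\<Phi> t) (u t) i x / D2" for i x
  define diss where "diss x = F'' (c1 t x) * (grad (c1 t) x \<bullet> grad (c1 t) x) +
      F'' (c2 t x) * (grad (c2 t) x \<bullet> grad (c2 t) x)" for x
  have V_cont: "continuous_on \<Omega> (V i)" "continuous_on \<Omega> (V' i)" for i
    unfolding V_def V'_def
    by (intro continuous_on_add continuous_on_divide continuous_on_const
        continuous_on_flux[OF _ evolves(4,3) open_domain t CF] evolves; use D1 D2 in simp)+
  have V0: "V i x = 0" "V' i x = 0" "diss x = 0" if "x \<in> \<Omega> - K" for i x
    using FK[OF tt that] by (simp_all add: V_def V'_def flux_def flux_partial_def diss_def)
  note reg = evolves_smoothly_on_partial_regularity(3,4)[OF _ open_domain t]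
  have V_deriv: "((\<lambda>s. V i (x + s *\<^sub>R axis i 1)) has_real_derivative V' i x) (at 0)" if "x \<in> \<Omega>" for i x
    unfolding V_def V'_def
    by (intro DERIV_add DERIV_cdivide DERIV_flux DF reg evolves that
        evolves_smoothly_on_differentiable[OF evolves_smoothly_on_component[OF evolves(3) open_domain] open_domain t])
  have V_int: "(LINT x|lborel. extend_zero \<Omega> (V' i) x) = 0" for i
    by (rule integral_extend_zero_directional_derivative[OF open_domain K(1,2) V_cont(1) V0(1) V_cont(2) V0(2) V_deriv])
  have pointwise: "rate t x \<le> (\<Sum>i\<in>UNIV. V' i x) - diss x" if x: "x \<in> \<Omega>" for x
  proof -
    note eqs = equations[OF t x]
    let ?L = "laplacian (\<Phi> t) x"
    let ?H1 = "c1 t x * F' (c1 t x) - F (c1 t x)" and ?H2 = "c2 t x * F' (c2 t x) - F (c2 t x)"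
    have r1: "F' (c1 t x) * dt c1 t x = (\<Sum>i\<in>UNIV. flux_partial D1 1 F F' F'' (c1 t) (\<Phi> t) (u t) i x)
           - D1 * (F'' (c1 t x) * (grad (c1 t) x \<bullet> grad (c1 t) x)) + D1 * 1 * ?H1 * ?L"
      by (rule renormalized_transport[OF reg(1)[OF evolves(1) x] reg(2)[OF evolves(1) x] reg(2)[OF evolves(4) x] eqs(4,1)])
    have r2: "F' (c2 t x) * dt c2 t x = (\<Sum>i\<in>UNIV. flux_partial D2 (- 1) F F' F'' (c2 t) (\<Phi> t) (u t) i x)
           - D2 * (F'' (c2 t x) * (grad (c2 t) x \<bullet> grad (c2 t) x)) + D2 * (- 1) * ?H2 * ?L"
      by (rule renormalized_transport[OF reg(1)[OF evolves(2) x] reg(2)[OF evolves(2) x] reg(2)[OF evolves(4) x] eqs(4,2)])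
    have "rate t x = (\<Sum>i\<in>UNIV. V' i x) - diss x + (?H1 - ?H2) * ?L"
      unfolding rate_def r1 r2 V'_def diss_def using D1 D2
      by (simp add: sum.distrib sum_divide_distrib[symmetric] add_divide_distrib diff_divide_distrib algebra_simps)
    moreover have "(?H1 - ?H2) * ?L \<le> 0"
    proof -
      have L: "?L = - ((c1 t x - c2 t x) / \<epsilon>)" using eqs(3) \<epsilon> by (simp add: field_simps)
      have nn: "c1 t x \<ge> 0" "c2 t x \<ge> 0" using concentrations_nonneg[of t x] t x by auto
      have "(?H1 - ?H2) * (c1 t x - c2 t x) \<ge> 0"
      proof (cases "c1 t x \<le> c2 t x")
        case True
        then show ?thesis
          using excess_entropy_mono[OF nn(1) True, of \<sigma> k] by (intro mult_nonpos_nonpos) (auto simp: F_def F'_def)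
      next
        case False
        then show ?thesis
          using excess_entropy_mono[OF nn(2), of "c1 t x" \<sigma> k] by (intro mult_nonneg_nonneg) (auto simp: F_def F'_def)
      qed
      then show ?thesis unfolding L using \<epsilon> by (simp add: divide_nonneg_pos)
    qed
    ultimately show ?thesis by simp
  qed
  have I: "integrable lborel (extend_zero \<Omega> h)" if "continuous_on \<Omega> h" "\<And>x. x \<in> \<Omega> - K \<Longrightarrow> h x = 0" for h
    using that by (rule integrable_extend_zero[OF open_domain K(1,2)])
  have "continuous_on \<Omega> (rate t)"
    unfolding rate_def
    by (intro continuous_on_add continuous_on_divide continuous_on_mult continuous_on_const compF[OF CF(2)]
        evolves_smoothly_on_continuous_space[OF _ t] evolves evolves_smoothly_on_dt open_domain) (use D1 D2 in auto)
  then have rate_int: "integrable lborel (extend_zero \<Omega> (rate t))" by (rule I) (rule f0(2)[OF tt])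
  have "continuous_on \<Omega> diss"
    unfolding diss_def
    by (intro continuous_on_add continuous_on_mult compF[OF CF(3)]
        evolves_smoothly_on_continuous_space[OF _ t] evolves continuous_grad_square t)
  then have diss_int: "integrable lborel (extend_zero \<Omega> diss)" by (rule I) (rule V0(3))
  have V'_int: "integrable lborel (extend_zero \<Omega> (V' i))" for i
    by (rule I[OF V_cont(2) V0(2)])
  have "(LINT x|lborel. extend_zero \<Omega> (rate t) x) \<le>
      (LINT x|lborel. (\<Sum>i\<in>UNIV. extend_zero \<Omega> (V' i) x) - extend_zero \<Omega> diss x)"
  proof (intro integral_mono Bochner_Integration.integrable_diff Bochner_Integration.integrable_sum rate_int diss_int V'_int)
    show "extend_zero \<Omega> (rate t) x \<le> (\<Sum>i\<in>UNIV. extend_zero \<Omega> (V' i) x) - extend_zero \<Omega> diss x" for x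
      using pointwise[of x] by (simp add: extend_zero_def)
  qed
  also have "\<dots> = - (LINT x|lborel. extend_zero \<Omega> diss x)"
    using diss_int V'_int V_int
    by (simp add: Bochner_Integration.integral_diff Bochner_Integration.integrable_sum Bochner_Integration.integral_sum)
  also have "\<dots> = - dissipation \<sigma> k t"
    by (simp add: dissipation_def diss_def[abs_def] F''_def \<sigma>)
  finally show ?thesis using deriv by blast
qed

lemma energy_antimono_time:
  assumes b: "barrier \<sigma> k" and "0 < s" "s \<le> t"
  shows "energy \<sigma> k t \<le> energy \<sigma> k s"
proof (rule DERIV_nonpos_imp_nonincreasing[OF assms(3)])
  fix r assume "s \<le> r"
  then have "r > 0" using assms(2) by linarith
  then show "\<exists>y. (energy \<sigma> k has_real_derivative y) (at r) \<and> y \<le> 0"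
    using energy_decay[OF b, of r] dissipation_nonneg[of \<sigma> k r] by force
qed

lemma energy_eq_0D:
  assumes b: "barrier \<sigma> k" and t: "t > 0" and zero: "energy \<sigma> k t = 0" and x: "x \<in> \<Omega>"
  shows "\<sigma> * c1 t x \<le> \<sigma> * k \<and> \<sigma> * c2 t x \<le> \<sigma> * k"
proof -
  obtain K where K: "compact K" "K \<subseteq> \<Omega>" "\<And>s x. s \<in> {t..t} \<Longrightarrow> x \<in> \<Omega> - K \<Longrightarrow> excess \<sigma> k (c1 s x) = 0"
    "\<And>s x. s \<in> {t..t} \<Longrightarrow> x \<in> \<Omega> - K \<Longrightarrow> excess \<sigma> k (c2 s x) = 0"
    using barrier_support[OF b t, of t] by metis
  let ?h = "extend_zero \<Omega> (\<lambda>x. excess \<sigma> k (c1 t x) ^ 4 / D1 + excess \<sigma> k (c2 t x) ^ 4 / D2)"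
  have "continuous_on UNIV ?h"
    by (rule continuous_on_extend_zero[OF open_domain compact_imp_closed[OF K(1)] K(2)];
        (intro continuous_on_add continuous_on_divide continuous_on_power continuous_on_const continuous_excess t)?;
        use D1 D2 K(3,4) in simp)
  then have "?h x = 0"
    using integrable_energy[OF b t]
    by (rule continuous_nonneg_integral_eq_0) (use D1 D2 zero in \<open>auto simp: extend_zero_def energy_def\<close>)
  then have "excess \<sigma> k (c1 t x) ^ 4 / D1 = 0" "excess \<sigma> k (c2 t x) ^ 4 / D2 = 0"
    using x D1 D2 by (simp_all add: extend_zero_def add_nonneg_eq_0_iff)
  then have "excess \<sigma> k (c1 t x) = 0" "excess \<sigma> k (c2 t x) = 0" using D1 D2 by simp_all
  then show ?thesis unfolding excess_def right_diff_distrib by linarith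
qed

section \<open>Comparison and decay to the boundary range\<close>

text \<open>At positive times the concentrations are continuous up to the boundary, so their bounds in \<open>\<Omega>\<close> hold for the
  boundary data too. Every level strictly beyond \<open>k\<close> is then a barrier at which the energy
  starts from 0.\<close>
lemma comparison:
  assumes \<sigma>: "\<sigma>\<^sup>2 = 1" and s: "0 < s" "s \<le> t" and x: "x \<in> \<Omega>"
    and le: "\<And>y. y \<in> \<Omega> \<Longrightarrow> \<sigma> * c1 s y \<le> \<sigma> * k \<and> \<sigma> * c2 s y \<le> \<sigma> * k"
  shows "\<sigma> * c1 t x \<le> \<sigma> * k \<and> \<sigma> * c2 t x \<le> \<sigma> * k"
proof -
  have slice: "continuous_on (closure \<Omega>) (\<lambda>y. \<sigma> * c1 s y)" "continuous_on (closure \<Omega>) (\<lambda>y. \<sigma> * c2 s y)"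
  proof -
    have "continuous_on (closure \<Omega>) (\<lambda>y. (s, y))"
      by (intro continuous_on_Pair continuous_on_const continuous_on_id)
    from continuous_on_compose2[OF continuous_closure(1) this] continuous_on_compose2[OF continuous_closure(2) this]
    show "continuous_on (closure \<Omega>) (\<lambda>y. \<sigma> * c1 s y)" "continuous_on (closure \<Omega>) (\<lambda>y. \<sigma> * c2 s y)"
      using s by (auto intro!: continuous_on_mult continuous_on_const)
  qed
  have bdry: "\<sigma> * \<gamma>1 y \<le> \<sigma> * k \<and> \<sigma> * \<gamma>2 y \<le> \<sigma> * k" if "y \<in> frontier \<Omega>" for y
  proof -
    have y: "y \<in> closure \<Omega>" using that by (simp add: frontier_def)
    then have "\<sigma> * c1 s y \<le> \<sigma> * k" by (rule continuous_le_on_closure[OF slice(1)]) (use le in blast)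
    moreover have "\<sigma> * c2 s y \<le> \<sigma> * k" using y by (rule continuous_le_on_closure[OF slice(2)]) (use le in blast)
    ultimately show ?thesis using boundary_values[OF s(1) that] by simp
  qed
  have "\<sigma> * c1 t x \<le> \<sigma> * k + \<eta> \<and> \<sigma> * c2 t x \<le> \<sigma> * k + \<eta>" if "\<eta> > 0" for \<eta>
  proof -
    let ?k = "k + \<sigma> * \<eta>"
    have k: "\<sigma> * ?k = \<sigma> * k + \<eta>" using \<sigma> by (simp add: algebra_simps power2_eq_square)
    have b: "barrier \<sigma> ?k" using \<sigma> bdry that unfolding barrier_def k by force
    have "excess \<sigma> ?k (c1 s y) = 0 \<and> excess \<sigma> ?k (c2 s y) = 0" if "y \<in> \<Omega>" for y
      using le[OF that] \<open>\<eta> > 0\<close> unfolding excess_def right_diff_distrib k by simp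
    then have "extend_zero \<Omega> (\<lambda>x. excess \<sigma> ?k (c1 s x) ^ 4 / D1 + excess \<sigma> ?k (c2 s x) ^ 4 / D2) = (\<lambda>_. 0)"
      by (auto simp: extend_zero_def)
    then have "energy \<sigma> ?k s = 0" by (simp add: energy_def)
    then have "energy \<sigma> ?k t = 0"
      using energy_antimono_time[OF b s] energy_nonneg[of \<sigma> ?k t] by simp
    then show ?thesis using energy_eq_0D[OF b _ _ x, of t] s k by auto
  qed
  then show ?thesis by (auto intro: field_le_epsilon)
qed

lemma concentrations_bounded:
  obtains B where "B \<ge> 0" "\<And>s x. s \<in> {0..t} \<Longrightarrow> x \<in> \<Omega> \<Longrightarrow> \<bar>c1 s x\<bar> \<le> B \<and> \<bar>c2 s x\<bar> \<le> B"
proof -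
  have "bounded ((\<lambda>(t, x). c1 t x) ` ({0..t} \<times> \<Omega>))" "bounded ((\<lambda>(t, x). c2 t x) ` ({0..t} \<times> \<Omega>))"
    using smooth_evolutions unfolding smooth_evolution_def by auto
  then obtain B1 B2 where B: "\<And>z. z \<in> (\<lambda>(t, x). c1 t x) ` ({0..t} \<times> \<Omega>) \<Longrightarrow> norm z \<le> B1"
    "\<And>z. z \<in> (\<lambda>(t, x). c2 t x) ` ({0..t} \<times> \<Omega>) \<Longrightarrow> norm z \<le> B2"
    unfolding bounded_iff by metis
  show ?thesis
  proof (rule that[of "max 0 (max B1 B2)"])
    show "\<bar>c1 s x\<bar> \<le> max 0 (max B1 B2) \<and> \<bar>c2 s x\<bar> \<le> max 0 (max B1 B2)"
      if "s \<in> {0..t}" "x \<in> \<Omega>" for s x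
      using B(1)[of "c1 s x"] B(2)[of "c2 s x"] that by force
  qed simp
qed

lemma measure_domain_finite: "emeasure lborel \<Omega> < \<infinity>"
  using bounded_domain emeasure_bounded_finite by blast

lemma integrable_const_domain: "integrable lborel (extend_zero \<Omega> (\<lambda>_. a))"
  and integral_const_domain: "(LINT x|lborel. extend_zero \<Omega> (\<lambda>_. a) x) = a * measure lborel \<Omega>"
proof -
  have eq: "extend_zero \<Omega> (\<lambda>_. a) = (\<lambda>x. indicator \<Omega> x * a)"
    by (auto simp: extend_zero_def)
  have i: "integrable lborel (indicator \<Omega> :: _ \<Rightarrow> real)"
    using measure_domain_finite open_domain by (intro integrable_real_indicator) auto
  show "integrable lborel (extend_zero \<Omega> (\<lambda>_. a))" unfolding eq using i by simp
  show "(LINT x|lborel. extend_zero \<Omega> (\<lambda>_. a) x) = a * measure lborel \<Omega>" unfolding eq using i by simp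
qed

lemma energy_bound:
  assumes b: "barrier \<sigma> k" and t: "t > 0"
    and B: "\<And>x. x \<in> \<Omega> \<Longrightarrow> excess \<sigma> k (c1 t x) \<le> B \<and> excess \<sigma> k (c2 t x) \<le> B"
  shows "energy \<sigma> k t \<le> (1 / D1 + 1 / D2) * B ^ 4 * measure lborel \<Omega>"
proof -
  have "energy \<sigma> k t \<le> (LINT x|lborel. extend_zero \<Omega> (\<lambda>_. (1 / D1 + 1 / D2) * B ^ 4) x)"
    unfolding energy_def
  proof (rule integral_mono[OF integrable_energy[OF b t] integrable_const_domain])
    fix x
    show "extend_zero \<Omega> (\<lambda>x. excess \<sigma> k (c1 t x) ^ 4 / D1 + excess \<sigma> k (c2 t x) ^ 4 / D2) x
        \<le> extend_zero \<Omega> (\<lambda>_. (1 / D1 + 1 / D2) * B ^ 4) x"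
    proof (cases "x \<in> \<Omega>")
      case True
      then have "excess \<sigma> k (c1 t x) ^ 4 \<le> B ^ 4" "excess \<sigma> k (c2 t x) ^ 4 \<le> B ^ 4"
        using B by (auto intro: power_mono)
      then have "excess \<sigma> k (c1 t x) ^ 4 / D1 + excess \<sigma> k (c2 t x) ^ 4 / D2 \<le> B ^ 4 / D1 + B ^ 4 / D2"
        using D1 D2 by (intro add_mono divide_right_mono) auto
      then show ?thesis using True by (simp add: extend_zero_def distrib_right)
    qed (simp add: extend_zero_def)
  qed
  then show ?thesis by (simp add: integral_const_domain)
qed

text \<open>At time 0 the boundary behaviour is unknown, but a bounded pointwise limit in \<open>\<Omega>\<close> is
  all that the energy sees.\<close>
lemma comparison_initial:
  assumes \<sigma>: "\<sigma>\<^sup>2 = 1" and t: "t \<ge> 0" and x: "x \<in> \<Omega>"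
    and init: "\<And>y. y \<in> \<Omega> \<Longrightarrow> \<sigma> * c10 y \<le> \<sigma> * k \<and> \<sigma> * c20 y \<le> \<sigma> * k"
    and bdry: "\<And>y. y \<in> frontier \<Omega> \<Longrightarrow> \<sigma> * \<gamma>1 y \<le> \<sigma> * k \<and> \<sigma> * \<gamma>2 y \<le> \<sigma> * k"
  shows "\<sigma> * c1 t x \<le> \<sigma> * k \<and> \<sigma> * c2 t x \<le> \<sigma> * k"
proof (cases "t = 0")
  case True
  then show ?thesis
    using init[OF x] smooth_evolutions(1,2) x unfolding smooth_evolution_def by auto
next
  case False
  with t have t: "t > 0" by simp
  have "\<sigma> * c1 t x \<le> \<sigma> * k + \<eta> \<and> \<sigma> * c2 t x \<le> \<sigma> * k + \<eta>" if "\<eta> > 0" for \<eta>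
  proof -
    let ?k = "k + \<sigma> * \<eta>"
    let ?h = "\<lambda>s x. excess \<sigma> ?k (c1 s x) ^ 4 / D1 + excess \<sigma> ?k (c2 s x) ^ 4 / D2"
    have k: "\<sigma> * ?k = \<sigma> * k + \<eta>" using \<sigma> by (simp add: algebra_simps power2_eq_square)
    have b: "barrier \<sigma> ?k" using \<sigma> bdry that unfolding barrier_def k by force
    obtain B where B: "B \<ge> 0" "\<And>s x. s \<in> {0..t} \<Longrightarrow> x \<in> \<Omega> \<Longrightarrow> \<bar>c1 s x\<bar> \<le> B \<and> \<bar>c2 s x\<bar> \<le> B"
      using concentrations_bounded by blast
    have \<sigma>1: "\<bar>\<sigma>\<bar> = 1" using \<sigma> by (simp add: power2_eq_1_iff) auto
    define s where "s n = t / real (Suc n)" for n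
    have s: "s n > 0" "s n \<le> t" for n using t by (auto simp: s_def field_simps)
    have s0: "s \<longlonglongrightarrow> 0" unfolding s_def by (rule LIMSEQ_Suc[OF lim_const_over_n])
    have lim: "(\<lambda>n. c (s n) y) \<longlonglongrightarrow> c 0 y"
      if "continuous_on ({0..} \<times> \<Omega>) (\<lambda>(t, x). c t x)" "y \<in> \<Omega>" for c :: "real \<Rightarrow> real^3 \<Rightarrow> real" and y
    proof -
      have "(\<lambda>n. (s n, y)) \<longlonglongrightarrow> (0, y)" using s0 by (intro tendsto_Pair tendsto_const)
      from continuous_on_tendsto_compose[OF that(1) this] show ?thesis
        using that(2) s by (auto simp: less_imp_le)
    qed
    have cont0: "continuous_on ({0..} \<times> \<Omega>) (\<lambda>(t, x). c1 t x)" "continuous_on ({0..} \<times> \<Omega>) (\<lambda>(t, x). c2 t x)"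
      and init': "y \<in> \<Omega> \<Longrightarrow> c1 0 y = c10 y" "y \<in> \<Omega> \<Longrightarrow> c2 0 y = c20 y" for y
      using smooth_evolutions(1,2) unfolding smooth_evolution_def by auto
    have "(\<lambda>n. LINT x|lborel. extend_zero \<Omega> (?h (s n)) x) \<longlonglongrightarrow> (LINT x|(lborel :: (real^3) measure). 0)"
    proof (rule integral_dominated_convergence)
      show "integrable lborel (extend_zero \<Omega> (\<lambda>_. (1 / D1 + 1 / D2) * (B + \<bar>?k\<bar>) ^ 4))"
        by (rule integrable_const_domain)
      show "extend_zero \<Omega> (?h (s n)) \<in> borel_measurable lborel" for n
        using integrable_energy[OF b s(1)] by (rule borel_measurable_integrable)
      show "AE x in lborel. (\<lambda>n. extend_zero \<Omega> (?h (s n)) x) \<longlonglongrightarrow> 0"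
      proof (rule AE_I2)
        fix y
        show "(\<lambda>n. extend_zero \<Omega> (?h (s n)) y) \<longlonglongrightarrow> 0"
        proof (cases "y \<in> \<Omega>")
          case True
          have "(\<lambda>n. ?h (s n) y) \<longlonglongrightarrow> ?h 0 y"
            unfolding excess_def
            by (intro tendsto_add tendsto_divide tendsto_power tendsto_max tendsto_mult tendsto_diff tendsto_const
                lim cont0 True) (use D1 D2 in auto)
          moreover have "excess \<sigma> ?k (c1 0 y) = 0 \<and> excess \<sigma> ?k (c2 0 y) = 0"
            using init[OF True] init'[OF True] \<open>\<eta> > 0\<close> unfolding excess_def right_diff_distrib k by simp
          ultimately show ?thesis using True by (simp add: extend_zero_def)
        qed (simp add: extend_zero_def)
      qed
      show "AE x in lborel. norm (extend_zero \<Omega> (?h (s n)) x) \<le> extend_zero \<Omega> (\<lambda>_. (1 / D1 + 1 / D2) * (B + \<bar>?k\<bar>) ^ 4) x" for n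
      proof (rule AE_I2)
        fix y
        show "norm (extend_zero \<Omega> (?h (s n)) y) \<le> extend_zero \<Omega> (\<lambda>_. (1 / D1 + 1 / D2) * (B + \<bar>?k\<bar>) ^ 4) y"
        proof (cases "y \<in> \<Omega>")
          case True
          have ex: "excess \<sigma> ?k a \<le> B + \<bar>?k\<bar>" if "\<bar>a\<bar> \<le> B" for a
          proof -
            have "\<sigma> * (a - ?k) \<le> \<bar>\<sigma>\<bar> * \<bar>a - ?k\<bar>" by (metis abs_ge_self abs_mult)
            then show ?thesis using that \<sigma>1 B(1) unfolding excess_def by auto
          qed
          have "excess \<sigma> ?k (c1 (s n) y) \<le> B + \<bar>?k\<bar>" "excess \<sigma> ?k (c2 (s n) y) \<le> B + \<bar>?k\<bar>"
            using B(2)[of "s n" y] s[of n] True by (auto intro!: ex)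
          then have "?h (s n) y \<le> (B + \<bar>?k\<bar>) ^ 4 / D1 + (B + \<bar>?k\<bar>) ^ 4 / D2"
            using D1 D2 by (intro add_mono divide_right_mono power_mono) auto
          moreover have "?h (s n) y \<ge> 0" using D1 D2 by simp
          ultimately show ?thesis using True by (simp add: extend_zero_def distrib_right)
        qed (simp add: extend_zero_def)
      qed
    qed simp
    then have "(\<lambda>n. energy \<sigma> ?k (s n)) \<longlonglongrightarrow> 0" by (simp add: energy_def)
    moreover have "energy \<sigma> ?k t \<le> energy \<sigma> ?k (s n)" for n
      using energy_antimono_time[OF b s] .
    ultimately have "energy \<sigma> ?k t \<le> 0" by (intro LIMSEQ_le_const) auto
    then have "energy \<sigma> ?k t = 0" using energy_nonneg[of \<sigma> ?k t] by simp
    then show ?thesis using energy_eq_0D[OF b _ _ x, of t] t k by auto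
  qed
  then show ?thesis by (auto intro: field_le_epsilon)
qed

text \<open>De Giorgi's iteration along the levels \<open>k + \<sigma> * \<delta> * (1 - 1 / 2 ^ (j + 1))\<close>. Already the first one is
  strictly beyond the boundary data. The energies are at most \<open>Y / 128 ^ j\<close>, and all of them dominate the energy at the limit
  level \<open>k + \<sigma> * \<delta>\<close>, which is therefore 0.\<close>
lemma eventual_bound:
  assumes \<sigma>: "\<sigma>\<^sup>2 = 1" and \<delta>: "\<delta> > 0" and x: "x \<in> \<Omega>"
    and bdry: "\<And>y. y \<in> frontier \<Omega> \<Longrightarrow> \<sigma> * \<gamma>1 y \<le> \<sigma> * k \<and> \<sigma> * \<gamma>2 y \<le> \<sigma> * k"
    and B: "\<And>y. y \<in> \<Omega> \<Longrightarrow> excess \<sigma> (k + \<sigma> * (\<delta> / 2)) (c1 1 y) \<le> B \<and> excess \<sigma> (k + \<sigma> * (\<delta> / 2)) (c2 1 y) \<le> B"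
    and t: "t \<ge> de_giorgi_time (1 / D1 + 1 / D2) (16 * (D1 + D2) / \<delta>\<^sup>2) ((1 / D1 + 1 / D2) * B ^ 4 * measure lborel \<Omega>)"
  shows "\<sigma> * c1 t x \<le> \<sigma> * k + \<delta> \<and> \<sigma> * c2 t x \<le> \<sigma> * k + \<delta>"
proof -
  define L A Y where "L = 1 / D1 + 1 / D2" and "A = 16 * (D1 + D2) / \<delta>\<^sup>2"
    and "Y = L * B ^ 4 * measure lborel \<Omega>"
  have L: "L > 0" using D1 D2 by (simp add: L_def add_pos_pos)
  have t1: "t \<ge> 1" "t > 0"
  proof -
    have "de_giorgi_time L A Y \<ge> 1" using L by (simp add: de_giorgi_time_def)
    then show "t \<ge> 1" "t > 0" using t by (simp_all add: L_def A_def Y_def)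
  qed
  have \<sigma>k: "\<sigma> * (k + \<sigma> * d) = \<sigma> * k + d" for d
    using \<sigma> by (simp add: algebra_simps power2_eq_square)
  define l where "l j = k + \<sigma> * (\<delta> * (1 - 1 / 2 ^ Suc j))" for j
  define d where "d j = \<delta> / 2 ^ (j + 2)" for j :: nat
  have d: "d j > 0" for j using \<delta> by (simp add: d_def)
  have l_Suc: "l (Suc j) = l j + \<sigma> * d j" for j
    by (simp add: l_def d_def field_simps)
  have b: "barrier \<sigma> (l j)" for j
  proof -
    have "(1::real) < 2 ^ Suc j" by (rule one_less_power) auto
    then have "1 / 2 ^ Suc j < (1::real)" by (subst divide_less_eq_1_pos) auto
    then have "\<delta> * (1 - 1 / 2 ^ Suc j) > 0" using \<delta> by simp
    then show ?thesis using bdry \<sigma> unfolding barrier_def l_def \<sigma>k by force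
  qed
  have decay: "energy \<sigma> (l j) t \<le> Y / 128 ^ j" for j
  proof (rule de_giorgi_decay[where y = "\<lambda>j. energy \<sigma> (l j)" and y' = "\<lambda>j. deriv (energy \<sigma> (l j))"
        and G = "\<lambda>j. dissipation \<sigma> (l j)" and A = A and L = L])
    show "energy \<sigma> (l 0) 1 \<le> Y"
      unfolding Y_def L_def by (rule energy_bound[OF b]) (use B in \<open>auto simp: l_def\<close>)
    show "(energy \<sigma> (l j) has_real_derivative deriv (energy \<sigma> (l j)) t) (at t)"
      "deriv (energy \<sigma> (l j)) t \<le> - dissipation \<sigma> (l j) t" if "t > 0" for j t
      using energy_decay[OF b[of j] that] DERIV_imp_deriv by (metis, metis)
    show "energy \<sigma> (l (Suc j)) t \<le> energy \<sigma> (l j) t" if "t > 0" for j t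
      unfolding l_Suc by (rule energy_antimono_level[OF b d that])
    show "energy \<sigma> (l (Suc j)) t \<le> L * (r\<^sup>2 * dissipation \<sigma> (l (Suc j)) t + 2 * (A * 4 ^ j * energy \<sigma> (l j) t)\<^sup>2 / r ^ 3)"
      if "t > 0" "r > 0" for j t r
    proof -
      have "(4::real) ^ j = 2 ^ j * 2 ^ j" by (simp add: power_mult_distrib[symmetric])
      then have "(D1 + D2) / (d j)\<^sup>2 = A * 4 ^ j"
        using \<delta> by (simp add: A_def d_def power2_eq_square field_simps)
      then have "mass \<sigma> (l (Suc j)) t \<le> A * 4 ^ j * energy \<sigma> (l j) t"
        using mass_chebyshev[OF b[of j] d[of j] that(1)] by (simp add: l_Suc)
      then have "(mass \<sigma> (l (Suc j)) t)\<^sup>2 \<le> (A * 4 ^ j * energy \<sigma> (l j) t)\<^sup>2"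
        using mass_nonneg by (rule power_mono)
      then have "L * (r\<^sup>2 * dissipation \<sigma> (l (Suc j)) t + 2 * (mass \<sigma> (l (Suc j)) t)\<^sup>2 / r ^ 3)
        \<le> L * (r\<^sup>2 * dissipation \<sigma> (l (Suc j)) t + 2 * (A * 4 ^ j * energy \<sigma> (l j) t)\<^sup>2 / r ^ 3)"
        using L that(2) by (intro mult_left_mono add_left_mono divide_right_mono) auto
      then show ?thesis using energy_nash[OF b[of "Suc j"] that] unfolding L_def by linarith
    qed
    show "de_giorgi_time L A Y \<le> t" using t by (simp add: L_def A_def Y_def)
  qed (use L energy_nonneg dissipation_nonneg in auto)
  have top: "barrier \<sigma> (k + \<sigma> * \<delta>)" using bdry \<sigma> \<delta> unfolding barrier_def \<sigma>k by force
  have "energy \<sigma> (k + \<sigma> * \<delta>) t \<le> Y / 128 ^ j" for j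
  proof -
    have "k + \<sigma> * \<delta> = l j + \<sigma> * (\<delta> / 2 ^ Suc j)" by (simp add: l_def algebra_simps)
    then have "energy \<sigma> (k + \<sigma> * \<delta>) t \<le> energy \<sigma> (l j) t"
      using energy_antimono_level[OF b[of j] _ t1(2), of "\<delta> / 2 ^ Suc j"] \<delta> by simp
    then show ?thesis using decay[of j] by linarith
  qed
  moreover have "(\<lambda>j. Y / 128 ^ j) \<longlonglongrightarrow> 0"
    using tendsto_mult[OF tendsto_const[of Y] LIMSEQ_inverse_realpow_zero[of 128]] by (simp add: divide_inverse)
  ultimately have "energy \<sigma> (k + \<sigma> * \<delta>) t \<le> 0" by (intro LIMSEQ_le_const) auto
  then have "energy \<sigma> (k + \<sigma> * \<delta>) t = 0" using energy_nonneg[of \<sigma> "k + \<sigma> * \<delta>" t] by simp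
  then show ?thesis using energy_eq_0D[OF top t1(2) _ x] unfolding \<sigma>k by simp
qed

section \<open>Suprema and infima of the concentrations\<close>

lemma bdd_slice:
  assumes "t \<ge> 0"
  shows "bdd_above (c1 t ` \<Omega>)" "bdd_above (c2 t ` \<Omega>)" "bdd_below (c1 t ` \<Omega>)" "bdd_below (c2 t ` \<Omega>)"
proof -
  obtain B where "B \<ge> 0" "\<And>s x. s \<in> {0..t} \<Longrightarrow> x \<in> \<Omega> \<Longrightarrow> \<bar>c1 s x\<bar> \<le> B \<and> \<bar>c2 s x\<bar> \<le> B"
    using concentrations_bounded by blast
  then have "\<bar>c1 t x\<bar> \<le> B \<and> \<bar>c2 t x\<bar> \<le> B" if "x \<in> \<Omega>" for x using that assms by simp
  then have B: "c1 t x \<le> B \<and> c2 t x \<le> B \<and> - B \<le> c1 t x \<and> - B \<le> c2 t x" if "x \<in> \<Omega>" for x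
    using that by (force simp: abs_le_iff)
  show "bdd_above (c1 t ` \<Omega>)" "bdd_above (c2 t ` \<Omega>)" "bdd_below (c1 t ` \<Omega>)" "bdd_below (c2 t ` \<Omega>)"
    using B by (auto intro: bdd_aboveI2[where M = B] bdd_belowI2[where m = "- B"])
qed

lemma min_inf_le_max_sup:
  assumes "t \<ge> 0"
  shows "min_inf \<Omega> (c1 t) (c2 t) \<le> max_sup \<Omega> (c1 t) (c2 t)"
proof -
  obtain x where "x \<in> \<Omega>" using domain_nonempty by blast
  then show ?thesis
    using min_inf_lower(1)[OF bdd_slice(3,4)[OF assms]] max_sup_upper(1)[OF bdd_slice(1,2)[OF assms]]
    by (meson order_trans)
qed

lemma max_sup_antimono: "antimono_on {0<..} (\<lambda>t. max_sup \<Omega> (c1 t) (c2 t))"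
proof (rule monotone_onI)
  fix s t :: real assume s: "s \<in> {0<..}" and st: "s \<le> t"
  have "c1 t x \<le> max_sup \<Omega> (c1 s) (c2 s) \<and> c2 t x \<le> max_sup \<Omega> (c1 s) (c2 s)" if "x \<in> \<Omega>" for x
    using comparison[of 1 s t x "max_sup \<Omega> (c1 s) (c2 s)"] s st that
      max_sup_upper[OF bdd_slice(1,2), of s] by auto
  then show "max_sup \<Omega> (c1 s) (c2 s) \<ge> max_sup \<Omega> (c1 t) (c2 t)"
    by (rule max_sup_least[OF domain_nonempty])
qed

lemma min_inf_mono: "mono_on {0<..} (\<lambda>t. min_inf \<Omega> (c1 t) (c2 t))"
proof (rule monotone_onI)
  fix s t :: real assume s: "s \<in> {0<..}" and st: "s \<le> t"
  have "min_inf \<Omega> (c1 s) (c2 s) \<le> c1 t x \<and> min_inf \<Omega> (c1 s) (c2 s) \<le> c2 t x" if "x \<in> \<Omega>" for x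
    using comparison[of "- 1" s t x "min_inf \<Omega> (c1 s) (c2 s)"] s st that
      min_inf_lower[OF bdd_slice(3,4), of s] by auto
  then show "min_inf \<Omega> (c1 s) (c2 s) \<le> min_inf \<Omega> (c1 t) (c2 t)"
    by (rule min_inf_greatest[OF domain_nonempty])
qed

end

theorem theorem4:
  fixes \<Omega> :: "(real^3) set"
    and D1 D2 \<epsilon> \<nu> K :: real
    and \<gamma>1 \<gamma>2 W c10 c20 :: "real^3 \<Rightarrow> real"
    and u0 :: "real^3 \<Rightarrow> real^3"
  assumes "smooth_bounded_domain \<Omega>"
    and "D1 > 0" "D2 > 0" "\<epsilon> > 0" "\<nu> > 0" "K > 0"
    and "smooth_on (frontier \<Omega>) \<gamma>1" "smooth_on (frontier \<Omega>) \<gamma>2" "smooth_on (frontier \<Omega>) W"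
    and "\<And>x. x \<in> frontier \<Omega> \<Longrightarrow> \<gamma>1 x > 0 \<and> \<gamma>2 x > 0"
    and "smooth_on (closure \<Omega>) c10" "smooth_on (closure \<Omega>) c20" "smooth_on (closure \<Omega>) u0"
    and "\<And>x. x \<in> \<Omega> \<Longrightarrow> c10 x \<ge> 0 \<and> c20 x \<ge> 0"
    and "\<And>x. x \<in> \<Omega> \<Longrightarrow> divergence u0 x = 0"
  shows "(\<forall>c1 c2 u \<Phi> p. npns_solution \<Omega> D1 D2 \<epsilon> \<nu> K \<gamma>1 \<gamma>2 W c10 c20 u0 c1 c2 u \<Phi> p \<longrightarrow>
            (\<forall>c\<in>{c1, c2}. \<forall>t\<ge>0. \<forall>x\<in>\<Omega>.
               Min {INF y\<in>\<Omega>. c10 y, INF y\<in>\<Omega>. c20 y, min_inf (frontier \<Omega>) \<gamma>1 \<gamma>2} \<le> c t x \<and>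
               c t x \<le> Max {SUP y\<in>\<Omega>. c10 y, SUP y\<in>\<Omega>. c20 y, max_sup (frontier \<Omega>) \<gamma>1 \<gamma>2}) \<and>
            antimono_on {0<..} (\<lambda>t. max_sup \<Omega> (c1 t) (c2 t)) \<and>
            mono_on {0<..} (\<lambda>t. min_inf \<Omega> (c1 t) (c2 t))) \<and>
         (\<forall>\<delta>>0. \<exists>T\<ge>0. \<forall>c1 c2 u \<Phi> p.
            npns_solution \<Omega> D1 D2 \<epsilon> \<nu> K \<gamma>1 \<gamma>2 W c10 c20 u0 c1 c2 u \<Phi> p \<longrightarrow>
            (\<forall>t\<ge>T. min_inf (frontier \<Omega>) \<gamma>1 \<gamma>2 - \<delta> \<le> min_inf \<Omega> (c1 t) (c2 t) \<and>
                   min_inf \<Omega> (c1 t) (c2 t) \<le> max_sup \<Omega> (c1 t) (c2 t) \<and>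
                   max_sup \<Omega> (c1 t) (c2 t) \<le> max_sup (frontier \<Omega>) \<gamma>1 \<gamma>2 + \<delta>))"
proof -
  define M m where "M = max_sup (frontier \<Omega>) \<gamma>1 \<gamma>2" and "m = min_inf (frontier \<Omega>) \<gamma>1 \<gamma>2"
  define top bot where "top = Max {SUP y\<in>\<Omega>. c10 y, SUP y\<in>\<Omega>. c20 y, M}"
    and "bot = Min {INF y\<in>\<Omega>. c10 y, INF y\<in>\<Omega>. c20 y, m}"
  have flow: "npns_flow \<Omega> D1 D2 \<epsilon> \<nu> K \<gamma>1 \<gamma>2 W c10 c20 u0 c1 c2 u \<Phi> p"
    if "npns_solution \<Omega> D1 D2 \<epsilon> \<nu> K \<gamma>1 \<gamma>2 W c10 c20 u0 c1 c2 u \<Phi> p" for c1 c2 u \<Phi> p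
    using assms(1-4) that by (rule npns_flow.intro)
  have ne: "\<Omega> \<noteq> {}" and bd: "bounded \<Omega>" using assms(1) by (auto simp: smooth_bounded_domain_def)
  note \<gamma>1_bdd = smooth_on_compact_bdd[OF compact_frontier_domain[OF assms(1)] assms(7)]
    and \<gamma>2_bdd = smooth_on_compact_bdd[OF compact_frontier_domain[OF assms(1)] assms(8)]
  have \<gamma>: "\<gamma>1 y \<le> M \<and> \<gamma>2 y \<le> M \<and> m \<le> \<gamma>1 y \<and> m \<le> \<gamma>2 y" if "y \<in> frontier \<Omega>" for y
    using max_sup_upper[OF \<gamma>1_bdd(1) \<gamma>2_bdd(1) that] min_inf_lower[OF \<gamma>1_bdd(2) \<gamma>2_bdd(2) that]
    by (simp add: M_def m_def)
  have cl: "compact (closure \<Omega>)" using bd by simp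
  have bdd0: "bdd_above (f ` \<Omega>)" "bdd_below (f ` \<Omega>)" if "smooth_on (closure \<Omega>) f" for f :: "real^3 \<Rightarrow> real"
    using smooth_on_compact_bdd[OF cl that] image_mono[OF closure_subset[of \<Omega>], of f]
    by (metis bdd_above_mono, metis bdd_below_mono)
  have init: "c10 y \<le> top \<and> c20 y \<le> top \<and> bot \<le> c10 y \<and> bot \<le> c20 y" if "y \<in> \<Omega>" for y
    using cSUP_upper[OF that bdd0(1)[OF assms(11)]] cSUP_upper[OF that bdd0(1)[OF assms(12)]]
      cINF_lower[OF bdd0(2)[OF assms(11)] that] cINF_lower[OF bdd0(2)[OF assms(12)] that]
    by (auto simp: top_def bot_def)
  have bdry: "\<gamma>1 y \<le> top \<and> \<gamma>2 y \<le> top \<and> bot \<le> \<gamma>1 y \<and> bot \<le> \<gamma>2 y" if "y \<in> frontier \<Omega>" for y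
    using \<gamma>[OF that] by (auto simp: top_def bot_def)
  have bounds: "bot \<le> c1 t x \<and> c1 t x \<le> top \<and> bot \<le> c2 t x \<and> c2 t x \<le> top"
    if sol: "npns_solution \<Omega> D1 D2 \<epsilon> \<nu> K \<gamma>1 \<gamma>2 W c10 c20 u0 c1 c2 u \<Phi> p" and "t \<ge> 0" "x \<in> \<Omega>"
    for c1 c2 u \<Phi> p t x
    using npns_flow.comparison_initial[OF flow[OF sol], of 1 t x top]
      npns_flow.comparison_initial[OF flow[OF sol], of "- 1" t x bot] init bdry that(2,3) by auto
  have long_time: "\<exists>T\<ge>0. \<forall>c1 c2 u \<Phi> p.
            npns_solution \<Omega> D1 D2 \<epsilon> \<nu> K \<gamma>1 \<gamma>2 W c10 c20 u0 c1 c2 u \<Phi> p \<longrightarrow>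
            (\<forall>t\<ge>T. m - \<delta> \<le> min_inf \<Omega> (c1 t) (c2 t) \<and>
                   min_inf \<Omega> (c1 t) (c2 t) \<le> max_sup \<Omega> (c1 t) (c2 t) \<and>
                   max_sup \<Omega> (c1 t) (c2 t) \<le> M + \<delta>)" if \<delta>: "\<delta> > 0" for \<delta>
  proof -
    \<comment> \<open>The excess at time 1 is bounded in terms of the data, which makes \<open>T\<close> the same for all solutions.\<close>
    define B where "B = \<bar>top\<bar> + \<bar>bot\<bar> + \<bar>M\<bar> + \<bar>m\<bar> + \<delta>"
    define T where "T = de_giorgi_time (1 / D1 + 1 / D2) (16 * (D1 + D2) / \<delta>\<^sup>2) ((1 / D1 + 1 / D2) * B ^ 4 * measure lborel \<Omega>)"
    have T: "T \<ge> 0" using assms(2,3) by (simp add: T_def de_giorgi_time_def)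
    have "m - \<delta> \<le> min_inf \<Omega> (c1 t) (c2 t) \<and> min_inf \<Omega> (c1 t) (c2 t) \<le> max_sup \<Omega> (c1 t) (c2 t) \<and>
        max_sup \<Omega> (c1 t) (c2 t) \<le> M + \<delta>"
      if sol: "npns_solution \<Omega> D1 D2 \<epsilon> \<nu> K \<gamma>1 \<gamma>2 W c10 c20 u0 c1 c2 u \<Phi> p" and t: "t \<ge> T" for c1 c2 u \<Phi> p t
    proof -
      interpret npns_flow \<Omega> D1 D2 \<epsilon> \<nu> K \<gamma>1 \<gamma>2 W c10 c20 u0 c1 c2 u \<Phi> p by (rule flow[OF sol])
      have ex: "excess 1 (M + 1 * (\<delta> / 2)) a \<le> B \<and> excess (- 1) (m + (- 1) * (\<delta> / 2)) a \<le> B"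
        if "bot \<le> a" "a \<le> top" for a
        using that \<delta> unfolding excess_def B_def by (auto simp: abs_if)
      have B: "excess 1 (M + 1 * (\<delta> / 2)) (c1 1 y) \<le> B \<and> excess 1 (M + 1 * (\<delta> / 2)) (c2 1 y) \<le> B"
        "excess (- 1) (m + (- 1) * (\<delta> / 2)) (c1 1 y) \<le> B \<and> excess (- 1) (m + (- 1) * (\<delta> / 2)) (c2 1 y) \<le> B"
        if "y \<in> \<Omega>" for y
        using bounds[OF sol _ that, of 1] ex by auto
      have "c1 t x \<le> M + \<delta> \<and> c2 t x \<le> M + \<delta>" if "x \<in> \<Omega>" for x
        using eventual_bound[OF _ \<delta> that _ B(1) t[unfolded T_def]] \<gamma> by auto
      moreover have "m - \<delta> \<le> c1 t x \<and> m - \<delta> \<le> c2 t x" if "x \<in> \<Omega>" for x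
        using eventual_bound[OF _ \<delta> that _ B(2) t[unfolded T_def]] \<gamma> by force
      ultimately show ?thesis
        using max_sup_least[OF ne] min_inf_greatest[OF ne] min_inf_le_max_sup T t by auto
    qed
    then show ?thesis using T by blast
  qed
  show ?thesis
    unfolding M_def[symmetric] m_def[symmetric]
    unfolding top_def[symmetric] bot_def[symmetric]
    using bounds npns_flow.max_sup_antimono[OF flow] npns_flow.min_inf_mono[OF flow] long_time
    by (intro conjI allI impI ballI) auto
qed

end
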